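(* Let $n\ge 1$ be an integer, let $p>1$, and let $f=e^{-\varphi}\in\mathscr{A}_0'$ and $g=e^{-\psi}\in\mathscr{A}_0'$ (so $\varphi,\psi\in\mathscr{L}_0'$). Suppose that $g$ is an admissible $p$-perturbation of $f$, i.e. there exists a constant $c>0$ such that $(\varphi^* )^p-c(\psi^* )^p$ is convex on $\mathbb{R}^n$. Then the limit $$\delta J_p(f,g)=\lim_{t\to0^+}\frac{J(f\oplus_p t\cdot_p g)-J(f)}{t}$$ exists and $$\delta J_p(f,g)=\frac{1}{p}\int_{\mathbb{R}^n}\big(\psi^*(\nabla\varphi(x))\big)^p\,\big(\varphi^*(\nabla\varphi(x))\big)^{1-p}\,e^{-\varphi(x)}\,dx=\frac{1}{p}\int_{\mathbb{R}^n}\big(\psi^*(y)\big)^p\,\big(\varphi^*(y)\big)^{1-p}\,d\mu(f,y).$$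
   Context: Classes of functions. $\mathscr{L}$ is the set of proper convex functions $\varphi:\mathbb{R}^n\to\mathbb{R}\cup\{+\infty\}$ with $\lim_{|x|\to\infty}\varphi(x)=+\infty$. $\mathscr{L}_0$ is the set of $\varphi\in\mathscr{L}$ that are lower semicontinuous, satisfy $\varphi\ge 0$ and $\varphi(0)=0$; $\mathscr{A}_0=\{e^{-\varphi}:\varphi\in\mathscr{L}_0\}$. $\mathscr{L}_0'$ is the set of $\varphi\in\mathscr{L}_0$ such that $\mathrm{dom}(\varphi)=\mathbb{R}^n$ (i.e. $\varphi$ is finite everywhere), $\varphi\in C^1(\mathbb{R}^n)$, $\varphi$ is twice continuously differentiable on $\mathbb{R}^n\setminus\{0\}$ with positive definite Hessian $\nabla^2\varphi(x)$ at every $x\neq 0$, $\varphi$ is strictly convex, and $\varphi$ is supercoercive: $\lim_{|x|\to\infty}\varphi(x)/|x|=+\infty$. $\mathscr{A}_0'=\{e^{-\varphi}:\varphi\in\mathscr{L}_0'\}$. Conjugate. $\varphi^*(y)=\sup_{x\in\mathbb{R}^n}(\langle x,y\rangle-\varphi(x))$ is the Legendre-Fenchel conjugate. Total mass. $J(f)=\int_{\mathbb{R}^n}f(x)\,dx$. $L_p$ Asplund sum. For $p>1$, $f=e^{-\varphi},g=e^{-\psi}\in\mathscr{A}_0$, one sets $f\oplus_p g=e^{-\varphi\Box_p\psi}$ with $\varphi\Box_p\psi=\big[((\varphi^* )^p+(\psi^* )^p)^{1/p}\big]^*$. For $t>0$, $t\cdot_p g=e^{-\psi\cdot_p t}$ with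 $(\psi\cdot_p t)(x)=t^{1/p}\psi(t^{-1/p}x)$. Thus $f\oplus_p t\cdot_p g=e^{-\varphi_t}$ with $\varphi_t=\big[((\varphi^* )^p+t(\psi^* )^p)^{1/p}\big]^*$. Measure. $\mu(f,\cdot)$ is the Borel measure on $\mathbb{R}^n$ obtained as the push-forward of the measure $e^{-\varphi(x)}\,dx$ under the map $\nabla\varphi:\mathbb{R}^n\to\mathbb{R}^n$, i.e. $\mu(f,A)=\int_{(\nabla\varphi)^{-1}(A)}e^{-\varphi(x)}\,dx$ for Borel $A$. Convention. The integrands are understood almost everywhere: the first is not defined by the formula at $x=0$ and the second at $y=0$ (where $\varphi^*$ vanishes), and these single points have measure zero. *)

theory Defs
  imports "HOL-Analysis.Analysis"
begin

subsection \<open>Classes of extended-real-valued convex functions\<close>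

definition proper :: "('a \<Rightarrow> ereal) \<Rightarrow> bool" where
  "proper \<phi> \<longleftrightarrow> (\<forall>x. \<phi> x \<noteq> -\<infinity>) \<and> (\<exists>x. \<phi> x \<noteq> \<infinity>)"

definition ereal_convex :: "('a::real_vector \<Rightarrow> ereal) \<Rightarrow> bool" where
  "ereal_convex \<phi> \<longleftrightarrow>
    (\<forall>x y. \<forall>u\<in>{0<..<1::real}.
       \<phi> (u *\<^sub>R x + (1 - u) *\<^sub>R y) \<le> ereal u * \<phi> x + ereal (1 - u) * \<phi> y)"

definition ereal_strictly_convex :: "('a::real_vector \<Rightarrow> ereal) \<Rightarrow> bool" where
  "ereal_strictly_convex \<phi> \<longleftrightarrow>
    (\<forall>x y. \<forall>u\<in>{0<..<1::real}. x \<noteq> y \<longrightarrow>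
       \<phi> (u *\<^sub>R x + (1 - u) *\<^sub>R y) < ereal u * \<phi> x + ereal (1 - u) * \<phi> y)"

definition lower_semicontinuous :: "('a::topological_space \<Rightarrow> ereal) \<Rightarrow> bool" where
  "lower_semicontinuous \<phi> \<longleftrightarrow> (\<forall>x. \<phi> x \<le> Liminf (at x) \<phi>)"

definition class_L :: "(real ^ 'n \<Rightarrow> ereal) set" where
  "class_L = {\<phi>. proper \<phi> \<and> ereal_convex \<phi> \<and> (\<phi> \<longlongrightarrow> \<infinity>) at_infinity}"

definition class_L0 :: "(real ^ 'n \<Rightarrow> ereal) set" where
  "class_L0 = {\<phi> \<in> class_L. lower_semicontinuous \<phi> \<and> (\<forall>x. 0 \<le> \<phi> x) \<and> \<phi> 0 = 0}"

text \<open>The gradient and the Hessian of an extended-real-valued function are those of its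
  real-valued representative; they are only used for functions that are finite everywhere.\<close>

definition grad :: "(real ^ 'n \<Rightarrow> ereal) \<Rightarrow> real ^ 'n \<Rightarrow> real ^ 'n" where
  "grad \<phi> x = (THE D. GDERIV (\<lambda>z. real_of_ereal (\<phi> z)) x :> D)"

definition hessian :: "(real ^ 'n \<Rightarrow> ereal) \<Rightarrow> real ^ 'n \<Rightarrow> real ^ 'n ^ 'n" where
  "hessian \<phi> x = jacobian (grad \<phi>) (at x)"

definition C1 :: "(real ^ 'n \<Rightarrow> ereal) \<Rightarrow> bool" where
  "C1 \<phi> \<longleftrightarrow> (\<forall>x. (\<lambda>z. real_of_ereal (\<phi> z)) differentiable (at x))
      \<and> continuous_on UNIV (grad \<phi>)"

text \<open>Symmetry of the Hessian is not part of positive definiteness below, since it is automatic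
  for twice continuously differentiable functions.\<close>

definition class_L0' :: "(real ^ 'n \<Rightarrow> ereal) set" where
  "class_L0' = {\<phi> \<in> class_L0.
      (\<forall>x. \<phi> x \<noteq> \<infinity>)
    \<and> C1 \<phi>
    \<and> (\<forall>x. x \<noteq> 0 \<longrightarrow> grad \<phi> differentiable (at x))
    \<and> continuous_on (- {0}) (hessian \<phi>)
    \<and> (\<forall>x v. x \<noteq> 0 \<and> v \<noteq> 0 \<longrightarrow> 0 < v \<bullet> (hessian \<phi> x *v v))
    \<and> ereal_strictly_convex \<phi>
    \<and> ((\<lambda>x. \<phi> x / ereal (norm x)) \<longlongrightarrow> \<infinity>) at_infinity}"

subsection \<open>Correspondence between functions and potentials\<close>

definition exp_neg :: "ereal \<Rightarrow> real" where
  "exp_neg a = (if a = \<infinity> then 0 else exp (- real_of_ereal a))"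

definition potential :: "('a \<Rightarrow> real) \<Rightarrow> 'a \<Rightarrow> ereal" where
  "potential f x = (if f x = 0 then \<infinity> else ereal (- ln (f x)))"

text \<open>Operations on \<open>f = exp (- \<phi>)\<close> are defined through \<open>potential f\<close>, which recovers \<open>\<phi>\<close>:\<close>

lemma potential_exp_neg:
  assumes "\<And>x. \<phi> x \<noteq> -\<infinity>"
  shows "potential (\<lambda>x. exp_neg (\<phi> x)) = \<phi>"
proof
  fix x show "potential (\<lambda>x. exp_neg (\<phi> x)) x = \<phi> x"
    using assms[of x] by (cases "\<phi> x") (auto simp: potential_def exp_neg_def)
qed

subsection \<open>Conjugates, the Asplund sum, total mass and the measure of a function\<close>

definition legendre :: "('a::real_inner \<Rightarrow> ereal) \<Rightarrow> 'a \<Rightarrow> ereal" where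
  "legendre \<phi> y = (SUP x. ereal (x \<bullet> y) - \<phi> x)"

text \<open>Only used for a base in \<open>[0, \<infinity>]\<close> and a positive exponent.\<close>

definition ereal_powr :: "ereal \<Rightarrow> real \<Rightarrow> ereal" where
  "ereal_powr a r = (if a = \<infinity> then \<infinity> else ereal (real_of_ereal a powr r))"

definition Lp_infconv ::
    "real \<Rightarrow> ('a::real_inner \<Rightarrow> ereal) \<Rightarrow> ('a \<Rightarrow> ereal) \<Rightarrow> 'a \<Rightarrow> ereal" where
  "Lp_infconv p \<phi> \<psi> =
    legendre (\<lambda>y. ereal_powr (ereal_powr (legendre \<phi> y) p + ereal_powr (legendre \<psi> y) p) (1 / p))"

definition Lp_sum ::
    "real \<Rightarrow> (real ^ 'n \<Rightarrow> real) \<Rightarrow> (real ^ 'n \<Rightarrow> real) \<Rightarrow> real ^ 'n \<Rightarrow> real" where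
  "Lp_sum p f g x = exp_neg (Lp_infconv p (potential f) (potential g) x)"

definition Lp_scale :: "real \<Rightarrow> real \<Rightarrow> (real ^ 'n \<Rightarrow> real) \<Rightarrow> real ^ 'n \<Rightarrow> real" where
  "Lp_scale p t g x = exp_neg (ereal (t powr (1 / p)) * potential g (t powr (- 1 / p) *\<^sub>R x))"

definition total_mass :: "(real ^ 'n \<Rightarrow> real) \<Rightarrow> real" where
  "total_mass f = (LINT x|lborel. f x)"

definition mu :: "(real ^ 'n \<Rightarrow> real) \<Rightarrow> (real ^ 'n) measure" where
  "mu f = distr (density lborel (\<lambda>x. ennreal (f x))) borel (grad (potential f))"

text \<open>Conjugates of functions in \<^const>\<open>class_L0'\<close> are finite everywhere because of
  supercoercivity, so passing to real values loses nothing.\<close>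

definition admissible_perturbation ::
    "real \<Rightarrow> (real ^ 'n \<Rightarrow> real) \<Rightarrow> (real ^ 'n \<Rightarrow> real) \<Rightarrow> bool" where
  "admissible_perturbation p f g \<longleftrightarrow>
    (\<exists>c>0. convex_on UNIV
       (\<lambda>y. real_of_ereal (legendre (potential f) y) powr p
             - c * real_of_ereal (legendre (potential g) y) powr p))"

definition difference_quotient ::
    "real \<Rightarrow> (real ^ 'n \<Rightarrow> real) \<Rightarrow> (real ^ 'n \<Rightarrow> real) \<Rightarrow> real \<Rightarrow> real" where
  "difference_quotient p f g t = (total_mass (Lp_sum p f (Lp_scale p t g)) - total_mass f) / t"

definition delta_J ::
    "real \<Rightarrow> (real ^ 'n \<Rightarrow> real) \<Rightarrow> (real ^ 'n \<Rightarrow> real) \<Rightarrow> real" where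
  "delta_J p f g = Lim (at_right 0) (difference_quotient p f g)"

end

theory Submission
  imports Defs
begin

text \<open>
  Write \<open>\<phi>\<^sub>t\<close> for the potential of \<open>f \<oplus>\<^sub>p t \<cdot>\<^sub>p g\<close>. It is the conjugate of
  \<open>((\<phi>\<^sup>*)\<^sup>p + t (\<psi>\<^sup>*)\<^sup>p)\<^bsup>1/p\<^esup>\<close>, and \<open>\<phi>\<^sub>t \<le> \<phi>\<close>. The difference quotient of the total mass is
  the integral of \<open>(exp (- \<phi>\<^sub>t) - exp (- \<phi>)) / t\<close>, so two things are needed: the pointwise
  limit of this quotient, and a reason to exchange limit and integral.

  Pointwise (\<open>perturbed_conjugate_derivative\<close>). If the maximiser in the conjugate defining
  \<open>\<phi>(x)\<close> is unique, then the derivative of the maximum in the parameter \<open>t\<close> is the derivative of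
  the objective at that maximiser. Here the maximiser is \<open>\<nabla>\<phi>(x)\<close>, and it is unique because \<open>\<phi>\<close> is
  differentiable at \<open>x\<close>. For \<open>x \<noteq> 0\<close> strict convexity gives \<open>\<phi>\<^sup>*(\<nabla>\<phi>(x)) > 0\<close>, so that the
  \<open>1/p\<close>-th power is smooth there.

  Exchange (\<open>Lp_variation_exp_neg\<close>). The pointwise bound suggests \<open>\<phi>\<^sup>*(\<nabla>\<phi>(x)) exp (- \<phi>\<^sub>t(x))\<close> as a majorant, up to a constant, but \<open>\<phi>\<^sub>t\<close> is smaller than
  \<open>\<phi>\<close> and \<open>\<nabla>\<phi>\<close> may grow too fast for \<open>exp (- \<phi>\<^sub>t)\<close>. Instead the majorant varies with \<open>t\<close>:
  admissibility forces \<open>c (\<psi>\<^sup>*)\<^sup>p \<le> (\<phi>\<^sup>*)\<^sup>p\<close> (\<open>powr_le_of_convex_diff\<close>), hence \<open>\<phi>\<^sub>t(x) \<ge> \<phi>(x / l)\<close> with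
  \<open>l = (1 + t/c)\<^bsup>1/p\<^esup>\<close>, and the quotients are at most
  \<open>(exp (- \<phi>(x / l)) - exp (- \<phi>(x))) / t\<close>. The integral of the latter is
  \<open>(l\<^sup>n - 1) / t\<close> times \<open>J(f)\<close> by scaling, and it converges to the integral of the pointwise limit
  because \<open>\<integral> \<langle>x, \<nabla>\<phi>(x)\<rangle> exp (- \<phi>(x)) dx = n J(f)\<close>
  (\<open>integral_inner_gradient_exp_neg\<close>). This is what Pratt's form of dominated convergence
  requires (\<open>Pratt_dominated_convergence\<close>).

  The formula with \<open>\<mu>(f, \<cdot>)\<close> is the change of variables for a push-forward.
\<close>

section \<open>Conjugates of real-valued functions\<close>

text \<open>The conjugates of interest are finite, so the analysis can run in the reals. Finiteness
  appears as boundedness of the range of \<open>x \<bullet> y - a x\<close>, since an unbounded set of reals has a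
  meaningless supremum; \<open>legendre_ereal\<close> transfers the results to the extended reals.\<close>

definition conjugate :: "('a::real_inner \<Rightarrow> real) \<Rightarrow> 'a \<Rightarrow> real" where
  "conjugate a y = (SUP x. x \<bullet> y - a x)"

lemma conjugate_upper:
  assumes "bdd_above (range (\<lambda>x. x \<bullet> y - a x))"
  shows "x \<bullet> y - a x \<le> conjugate a y"
  unfolding conjugate_def using assms by (intro cSUP_upper) auto

lemma conjugate_least:
  assumes "\<And>x. x \<bullet> y - a x \<le> b"
  shows "conjugate a y \<le> b"
  unfolding conjugate_def using assms by (intro cSUP_least) auto

lemma conjugate_nonneg:
  assumes "bdd_above (range (\<lambda>x. x \<bullet> y - a x))" "a 0 = 0"
  shows "0 \<le> conjugate a y"
  using conjugate_upper[OF assms(1), of 0] assms(2) by simp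

lemma conjugate_zero:
  assumes "a 0 = 0" "\<And>x. 0 \<le> a x"
  shows "conjugate a 0 = 0"
proof (rule antisym)
  show "conjugate a 0 \<le> 0" using assms by (intro conjugate_least) simp
  show "0 \<le> conjugate a 0" using assms by (intro conjugate_nonneg bdd_aboveI2[of _ _ 0]) auto
qed

lemma convex_conjugate:
  assumes "\<And>y. bdd_above (range (\<lambda>x. x \<bullet> y - a x))"
  shows "convex_on UNIV (conjugate a)"
  unfolding convex_on_def
proof (intro conjI ballI allI impI)
  fix y z :: 'a and u v :: real
  assume uv: "0 \<le> u" "0 \<le> v" "u + v = 1"
  show "conjugate a (u *\<^sub>R y + v *\<^sub>R z) \<le> u * conjugate a y + v * conjugate a z"
  proof (rule conjugate_least)
    fix x
    have "u * (x \<bullet> y - a x) + v * (x \<bullet> z - a x) \<le> u * conjugate a y + v * conjugate a z"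
      using uv by (intro add_mono mult_left_mono conjugate_upper assms) auto
    moreover have "u * (x \<bullet> y - a x) + v * (x \<bullet> z - a x)
        = x \<bullet> (u *\<^sub>R y + v *\<^sub>R z) - (u + v) * a x"
      by (simp add: inner_add_right algebra_simps)
    ultimately show "x \<bullet> (u *\<^sub>R y + v *\<^sub>R z) - a x \<le> u * conjugate a y + v * conjugate a z"
      using uv by simp
  qed
qed auto

lemma legendre_ereal:
  assumes bdd: "bdd_above (range (\<lambda>x. x \<bullet> y - a x))"
  shows "legendre (\<lambda>x. ereal (a x)) y = ereal (conjugate a y)"
  unfolding legendre_def
proof (rule antisym)
  show "(SUP x. ereal (x \<bullet> y) - ereal (a x)) \<le> ereal (conjugate a y)"
    using conjugate_upper[OF bdd] by (intro SUP_least) simp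
next
  define S where "S = (SUP x. ereal (x \<bullet> y) - ereal (a x))"
  have up: "ereal (x \<bullet> y - a x) \<le> S" for x
    unfolding S_def by (rule SUP_upper2[of x]) auto
  show "ereal (conjugate a y) \<le> S"
  proof (cases S)
    case (real s)
    with up have "conjugate a y \<le> s" by (intro conjugate_least) simp
    with real show ?thesis by simp
  qed (use up[of 0] in auto)
qed

text \<open>Superlinear growth beats every linear functional.\<close>

lemma bdd_above_conjugate:
  fixes a :: "'a::euclidean_space \<Rightarrow> real"
  assumes cont: "continuous_on UNIV a"
    and super: "filterlim (\<lambda>x. a x / norm x) at_top at_infinity"
  shows "bdd_above (range (\<lambda>x. x \<bullet> y - a x))"
proof -
  have "\<forall>\<^sub>F x in at_infinity. norm y \<le> a x / norm x"
    using super by (simp add: filterlim_at_top)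
  then obtain R where R: "\<And>x. R \<le> norm x \<Longrightarrow> norm y \<le> a x / norm x"
    by (auto simp: eventually_at_infinity)
  have "compact ((\<lambda>x. x \<bullet> y - a x) ` cball 0 (max R 1))"
    by (intro compact_continuous_image continuous_intros continuous_on_subset[OF cont]) auto
  then obtain M where M: "\<And>x. norm x \<le> max R 1 \<Longrightarrow> x \<bullet> y - a x \<le> M"
    by (force dest!: compact_imp_bounded bounded_imp_bdd_above simp: bdd_above_def)
  have "x \<bullet> y - a x \<le> max M 0" for x
  proof (cases "norm x \<le> max R 1")
    case False
    then have "R \<le> norm x" "0 < norm x" by auto
    then have "norm y * norm x \<le> a x" using R[of x] by (simp only: pos_le_divide_eq)
    then show ?thesis using norm_cauchy_schwarz[of x y] by (simp add: mult.commute)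
  qed (use M[of x] in auto)
  then show ?thesis by (intro bdd_aboveI2)
qed

lemma convex_on_gradient_le:
  fixes a :: "'a::real_inner \<Rightarrow> real"
  assumes conv: "convex_on UNIV a" and grad: "GDERIV a x :> d"
  shows "a x + (z - x) \<bullet> d \<le> a z"
proof -
  define h where "h s = a (x + s *\<^sub>R (z - x))" for s :: real
  have "(h has_field_derivative (z - x) \<bullet> d) (at 0)"
  proof -
    have "((\<lambda>s. x + s *\<^sub>R (z - x)) has_derivative (\<lambda>s. s *\<^sub>R (z - x))) (at 0)"
      by (auto intro!: derivative_eq_intros)
    moreover have "(a has_derivative (\<lambda>k. k \<bullet> d)) (at (x + 0 *\<^sub>R (z - x)))"
      using grad by (simp add: gderiv_def)
    ultimately have "(h has_derivative (\<lambda>s. (s *\<^sub>R (z - x)) \<bullet> d)) (at 0)"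
      unfolding h_def using has_derivative_compose[of "\<lambda>s. x + s *\<^sub>R (z - x)"] by blast
    then show ?thesis
      by (simp add: has_field_derivative_def mult.commute[of _ "_ \<bullet> _"] cong: if_cong)
  qed
  then have lim: "((\<lambda>s. (h s - h 0) / s) \<longlongrightarrow> (z - x) \<bullet> d) (at_right 0)"
    by (auto simp: DERIV_def intro: filterlim_mono[OF _ order_refl at_le])
  have "(h s - h 0) / s \<le> a z - a x" if "0 < s" "s < 1" for s
  proof -
    have "a ((1 - s) *\<^sub>R x + s *\<^sub>R z) \<le> (1 - s) * a x + s * a z"
      using conv that by (intro convex_onD) auto
    moreover have "(1 - s) *\<^sub>R x + s *\<^sub>R z = x + s *\<^sub>R (z - x)" by (simp add: algebra_simps)
    ultimately show ?thesis using that by (simp add: h_def field_simps)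
  qed
  then have "\<forall>\<^sub>F s in at_right 0. (h s - h 0) / s \<le> a z - a x"
    by (auto simp: eventually_at_right_field intro!: exI[of _ 1])
  from tendsto_upperbound[OF lim this] show ?thesis by simp
qed

text \<open>By the gradient inequality, \<open>x\<close> maximises \<open>z \<bullet> d - a z\<close>.\<close>

lemma Fenchel_equality:
  fixes a :: "'a::real_inner \<Rightarrow> real"
  assumes conv: "convex_on UNIV a" and grad: "GDERIV a x :> d"
  shows "conjugate a d = x \<bullet> d - a x"
proof (rule antisym)
  have le: "z \<bullet> d - a z \<le> x \<bullet> d - a x" for z
    using convex_on_gradient_le[OF assms, of z] by (simp add: inner_diff_left)
  then show "conjugate a d \<le> x \<bullet> d - a x" by (rule conjugate_least)
  show "x \<bullet> d - a x \<le> conjugate a d" by (intro conjugate_upper bdd_aboveI2[OF le])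
qed

text \<open>Differentiability of \<open>a\<close> at \<open>x\<close> makes \<open>d\<close> the only maximiser of \<open>x \<bullet> y - A y\<close>, with a gap away
  from it: testing \<open>A y\<close> at \<open>x + k\<close>, where \<open>k\<close> is short and points in the direction \<open>y - d\<close>, gains
  \<open>k \<bullet> (y - d)\<close> and loses only the first-order remainder of \<open>a\<close>.\<close>

lemma conjugate_gap:
  fixes a :: "'a::real_inner \<Rightarrow> real"
  assumes A: "\<And>z y. z \<bullet> y - a z \<le> A y" and grad: "GDERIV a x :> d" and "0 < \<delta>"
  obtains \<eta> where "0 < \<eta>" "\<And>y. \<delta> \<le> dist y d \<Longrightarrow> x \<bullet> y - A y \<le> a x - \<eta>"
proof -
  have "(a has_derivative (\<lambda>k. k \<bullet> d)) (at x)" using grad by (simp add: gderiv_def)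
  then obtain r where "0 < r"
    and r: "\<And>z. norm (z - x) < r \<Longrightarrow> norm (a z - a x - (z - x) \<bullet> d) \<le> \<delta> / 2 * norm (z - x)"
    using \<open>0 < \<delta>\<close> unfolding has_derivative_at_alt by (metis half_gt_zero)
  show ?thesis
  proof (rule that[of "r * \<delta> / 4"])
    show "0 < r * \<delta> / 4" using \<open>0 < r\<close> \<open>0 < \<delta>\<close> by simp
    fix y assume y: "\<delta> \<le> dist y d"
    define k where "k = (r / 2 / norm (y - d)) *\<^sub>R (y - d)"
    have n: "0 < norm (y - d)" using y \<open>0 < \<delta>\<close> by (auto simp: dist_norm)
    have k: "norm k = r / 2" using n \<open>0 < r\<close> by (simp add: k_def)
    have kd: "k \<bullet> y - k \<bullet> d = r / 2 * norm (y - d)"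
    proof -
      have "k \<bullet> y - k \<bullet> d = r / 2 / norm (y - d) * ((y - d) \<bullet> (y - d))"
        unfolding k_def by (simp add: inner_diff_right right_diff_distrib)
      then show ?thesis using n by (simp add: power2_eq_square flip: power2_norm_eq_inner)
    qed
    have "a (x + k) - a x - k \<bullet> d \<le> \<delta> / 2 * (r / 2)"
      using abs_le_D1[OF r[of "x + k", unfolded real_norm_def]] k \<open>0 < r\<close> by simp
    moreover have "(x + k) \<bullet> y - a (x + k) \<le> A y" by (rule A)
    moreover have "r / 2 * \<delta> \<le> r / 2 * norm (y - d)"
      using y \<open>0 < r\<close> by (simp add: dist_norm)
    ultimately show "x \<bullet> y - A y \<le> a x - r * \<delta> / 4"
      using kd by (simp add: inner_add_left algebra_simps)
  qed
qed

lemma conjugate_scale: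
  fixes b :: "'a::real_inner \<Rightarrow> real"
  assumes s: "0 < s" and bdd: "bdd_above (range (\<lambda>x. x \<bullet> y - b x))"
  shows "bdd_above (range (\<lambda>x. x \<bullet> y - s * b (inverse s *\<^sub>R x)))"
    and "conjugate (\<lambda>x. s * b (inverse s *\<^sub>R x)) y = s * conjugate b y"
proof -
  have eq: "x \<bullet> y - s * b (inverse s *\<^sub>R x) = s * ((inverse s *\<^sub>R x) \<bullet> y - b (inverse s *\<^sub>R x))" for x
    using s by (simp add: right_diff_distrib)
  have le: "x \<bullet> y - s * b (inverse s *\<^sub>R x) \<le> s * conjugate b y" for x
    unfolding eq using s by (intro mult_left_mono conjugate_upper bdd) auto
  then show bdd': "bdd_above (range (\<lambda>x. x \<bullet> y - s * b (inverse s *\<^sub>R x)))"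
    by (rule bdd_aboveI2)
  have "z \<bullet> y - b z \<le> conjugate (\<lambda>x. s * b (inverse s *\<^sub>R x)) y / s" for z
    using conjugate_upper[OF bdd', of "s *\<^sub>R z"] s by (simp add: field_simps)
  then have "conjugate b y \<le> conjugate (\<lambda>x. s * b (inverse s *\<^sub>R x)) y / s"
    by (rule conjugate_least)
  with s have "s * conjugate b y \<le> conjugate (\<lambda>x. s * b (inverse s *\<^sub>R x)) y"
    by (simp add: field_simps)
  with conjugate_least[OF le] show "conjugate (\<lambda>x. s * b (inverse s *\<^sub>R x)) y = s * conjugate b y"
    by (rule antisym)
qed

section \<open>The perturbed conjugate\<close>

text \<open>The integrand \<open>(u\<^sup>p + t v\<^sup>p)\<^bsup>1/p\<^esup>\<close> of the \<open>L\<^sub>p\<close> sum, with the dilation of the second summand by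
  \<open>t\<close> already carried out.\<close>

definition Lp_comb :: "real \<Rightarrow> real \<Rightarrow> real \<Rightarrow> real \<Rightarrow> real" where
  "Lp_comb p t u v = (u powr p + t * v powr p) powr (1 / p)"

text \<open>The graph of a concave power lies below its tangent at \<open>r\<close>. Both bounds on
  \<open>Lp_comb p t u v - u\<close> below come from this: the upper one from the tangent at \<open>u\<^sup>p\<close>, the lower
  one from the tangent at \<open>u\<^sup>p + t v\<^sup>p\<close>.\<close>

lemma powr_le_tangent:
  fixes q s r :: real
  assumes "0 \<le> q" "q \<le> 1" "0 < r" "0 < s"
  shows "s powr q \<le> r powr q + q * r powr (q - 1) * (s - r)"
proof -
  have "s powr q * r powr (1 - q) \<le> q * s + (1 - q) * r"
    using assms by (intro Youngs_inequality_0) auto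
  then have "s powr q * r powr (1 - q) * r powr (q - 1) \<le> (q * s + (1 - q) * r) * r powr (q - 1)"
    by (intro mult_right_mono) auto
  moreover have "r powr (1 - q) * r powr (q - 1) = 1"
    using assms by (simp flip: powr_add)
  moreover have "r * r powr (q - 1) = r powr q"
    using assms powr_mult_base[of r "q - 1"] by simp
  ultimately have "s powr q \<le> q * s * r powr (q - 1) + (1 - q) * r powr q"
    by (simp add: distrib_right mult.assoc del: mult_eq_0_iff)
  then show ?thesis
    using \<open>r * r powr (q - 1) = r powr q\<close> by (simp add: algebra_simps)
qed

lemma Lp_comb_ge:
  assumes "1 < p" "0 \<le> t" "0 \<le> u"
  shows "u \<le> Lp_comb p t u v"
proof -
  have "(u powr p) powr (1 / p) \<le> (u powr p + t * v powr p) powr (1 / p)"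
    using assms by (intro powr_mono2) auto
  then show ?thesis using assms by (simp add: Lp_comb_def powr_powr)
qed

lemma Lp_comb_upper:
  assumes "1 < p" "0 \<le> t" "0 < u"
  shows "Lp_comb p t u v - u \<le> t * (1 / p * (v powr p * u powr (1 - p)))"
proof -
  have e: "p * (1 / p - 1) = 1 - p" using assms by (simp add: field_simps)
  have "u powr p + t * v powr p > 0"
    using assms by (intro add_pos_nonneg) auto
  then have "Lp_comb p t u v \<le> (u powr p) powr (1/p) + 1/p * (u powr p) powr (1/p - 1) * (t * v powr p)"
    unfolding Lp_comb_def
    using powr_le_tangent[of "1/p" "u powr p" "u powr p + t * v powr p"] assms by simp
  then show ?thesis using assms by (simp add: powr_powr e mult_ac)
qed

lemma Lp_comb_lower:
  assumes "1 < p" "0 \<le> t" "0 < u"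
  shows "t * (1 / p * (v powr p * (u powr p + t * v powr p) powr (1 / p - 1))) \<le> Lp_comb p t u v - u"
proof -
  have pos: "u powr p + t * v powr p > 0"
    using assms by (intro add_pos_nonneg) auto
  have "(u powr p) powr (1/p) \<le> Lp_comb p t u v
      + 1/p * (u powr p + t * v powr p) powr (1/p - 1) * (u powr p - (u powr p + t * v powr p))"
    unfolding Lp_comb_def using assms pos by (intro powr_le_tangent) auto
  then show ?thesis using assms by (simp add: powr_powr mult_ac)
qed

lemma bdd_above_conjugate_Lp_comb:
  assumes "1 < p" "0 \<le> t" and A: "\<And>z y. z \<bullet> y - a z \<le> A y" "\<And>y. 0 \<le> A y"
  shows "y \<bullet> x - Lp_comb p t (A y) (B y) \<le> a x"
    and "bdd_above (range (\<lambda>y. y \<bullet> x - Lp_comb p t (A y) (B y)))"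
proof -
  have le: "y \<bullet> x - Lp_comb p t (A y) (B y) \<le> a x" for y
    using Lp_comb_ge[OF assms(1,2) A(2)[of y], of "B y"] A(1)[of x y] by (simp add: inner_commute)
  then show "y \<bullet> x - Lp_comb p t (A y) (B y) \<le> a x"
    and "bdd_above (range (\<lambda>y. y \<bullet> x - Lp_comb p t (A y) (B y)))"
    by (auto intro: bdd_aboveI2[of _ _ "a x"])
qed

text \<open>An envelope theorem. Evaluating the perturbed supremum at \<open>d\<close> bounds the quotient above by
  its limit for every \<open>t > 0\<close>. For the lower bound the supremum is split: at distance at least
  \<open>\<delta>\<close> from \<open>d\<close> the gap \<open>\<eta>\<close> absorbs the first-order term once \<open>t\<close> is small, and near \<open>d\<close> the lower
  bound on \<open>Lp_comb\<close> is jointly continuous in \<open>t\<close> and \<open>y\<close>.\<close>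

lemma perturbed_conjugate_derivative:
  fixes a A B :: "'a::real_inner \<Rightarrow> real"
  assumes p: "1 < p"
    and A: "\<And>z y. z \<bullet> y - a z \<le> A y" "\<And>y. 0 \<le> A y"
    and grad: "GDERIV a x :> d" and eq: "A d = x \<bullet> d - a x" and pos: "0 < A d"
    and cont: "isCont A d" "isCont B d" and B: "\<And>y. 0 \<le> B y"
  shows "((\<lambda>t. (a x - conjugate (\<lambda>y. Lp_comb p t (A y) (B y)) x) / t)
            \<longlongrightarrow> 1 / p * (B d powr p * A d powr (1 - p))) (at_right 0)"
    (is "(?q \<longlongrightarrow> ?L) _")
proof (rule order_tendstoI)
  fix m assume m: "?L < m"
  have "?q t < m" if t: "0 < t" for t
  proof -
    have "d \<bullet> x - Lp_comb p t (A d) (B d) \<le> conjugate (\<lambda>y. Lp_comb p t (A y) (B y)) x"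
      using t by (intro conjugate_upper bdd_above_conjugate_Lp_comb[where a = a] p A) auto
    with Lp_comb_upper[OF p _ pos, of t "B d"] t eq inner_commute[of d x]
    have "a x - conjugate (\<lambda>y. Lp_comb p t (A y) (B y)) x \<le> t * ?L" by simp
    then have "?q t \<le> ?L" using t by (simp add: field_simps)
    with m show ?thesis by simp
  qed
  then show "\<forall>\<^sub>F t in at_right 0. ?q t < m"
    by (auto simp: eventually_at_right_field intro!: exI[of _ 1])
next
  fix m assume m: "m < ?L"
  obtain m' where m': "m < m'" "m' < ?L" using dense[OF m] by blast
  \<comment> \<open>\<open>F\<close> is the lower bound for the slope in \<open>t\<close> given by \<open>Lp_comb_lower\<close>.\<close>
  define F where "F t y = 1 / p * (B y powr p * (A y powr p + t * B y powr p) powr (1 / p - 1))" for t y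
  have e: "p * (1 / p - 1) = 1 - p" using p by (simp add: field_simps)
  have tA: "((\<lambda>z::real \<times> 'a. A (snd z)) \<longlongrightarrow> A d) (nhds 0 \<times>\<^sub>F nhds d)"
    and tB: "((\<lambda>z::real \<times> 'a. B (snd z)) \<longlongrightarrow> B d) (nhds 0 \<times>\<^sub>F nhds d)"
    using cont unfolding isCont_def
    by (auto intro!: filterlim_compose[OF _ filterlim_snd] simp: tendsto_nhds_iff)
  have "((\<lambda>z. F (fst z) (snd z)) \<longlongrightarrow> F 0 d) (nhds 0 \<times>\<^sub>F nhds d)"
    unfolding F_def
    by (intro tendsto_intros tA tB filterlim_fst) (use p pos B in \<open>auto intro!: always_eventually\<close>)
  moreover have "F 0 d = ?L" using p by (simp add: F_def powr_powr e)
  ultimately have "\<forall>\<^sub>F z in nhds 0 \<times>\<^sub>F nhds d. m' < F (fst z) (snd z) \<and> 0 < A (snd z)"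
    using m'(2) pos by (intro eventually_conj order_tendstoD(1)[OF tA] order_tendstoD(1)) auto
  then obtain P Q where PQ: "eventually P (nhds 0)" "eventually Q (nhds d)"
    and near: "\<And>t y. P t \<Longrightarrow> Q y \<Longrightarrow> m' < F t y \<and> 0 < A y"
    unfolding eventually_prod_filter by auto
  from PQ(1) obtain \<tau> where \<tau>: "0 < \<tau>" "\<And>t. dist t 0 < \<tau> \<Longrightarrow> P t"
    unfolding eventually_nhds_metric by auto
  from PQ(2) obtain \<delta> where \<delta>: "0 < \<delta>" "\<And>y. dist y d < \<delta> \<Longrightarrow> Q y"
    unfolding eventually_nhds_metric by auto
  obtain \<eta> where \<eta>: "0 < \<eta>" "\<And>y. \<delta> \<le> dist y d \<Longrightarrow> x \<bullet> y - A y \<le> a x - \<eta>"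
    using conjugate_gap[OF A(1) grad \<delta>(1)] by blast
  have "m < ?q t" if t: "0 < t" "t < \<tau>" "t * m' < \<eta>" for t
  proof -
    have "conjugate (\<lambda>y. Lp_comb p t (A y) (B y)) x \<le> a x - t * m'"
    proof (rule conjugate_least)
      fix y
      show "y \<bullet> x - Lp_comb p t (A y) (B y) \<le> a x - t * m'"
      proof (cases "dist y d < \<delta>")
        case True
        then have Fy: "m' < F t y" "0 < A y" using near[of t y] \<delta>(2) \<tau>(2)[of t] t by auto
        have "t * m' \<le> t * F t y" using Fy t by simp
        also have "\<dots> \<le> Lp_comb p t (A y) (B y) - A y"
          unfolding F_def using p t Fy(2) by (intro Lp_comb_lower) auto
        finally show ?thesis using A(1)[of x y] by (simp add: inner_commute)
      next
        case False
        then have "x \<bullet> y - A y \<le> a x - \<eta>" using \<eta>(2) by simp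
        with Lp_comb_ge[OF p _ A(2), of t y "B y"] t show ?thesis by (simp add: inner_commute)
      qed
    qed
    then have "m' \<le> ?q t" using t by (simp add: field_simps)
    with m' show ?thesis by simp
  qed
  moreover have "\<forall>\<^sub>F t in at_right 0. 0 < t \<and> t < \<tau> \<and> t * m' < \<eta>"
  proof (intro eventually_conj)
    have "((\<lambda>t. t * m') \<longlongrightarrow> 0 * m') (at_right 0)" by (intro tendsto_intros)
    then show "\<forall>\<^sub>F t in at_right 0. t * m' < \<eta>" using \<eta>(1) by (intro order_tendstoD) auto
    show "\<forall>\<^sub>F t in at_right 0. t < \<tau>"
      using \<tau>(1) by (auto simp: eventually_at_right_field)
  qed (auto simp: eventually_at_right_less)
  ultimately show "\<forall>\<^sub>F t in at_right 0. m < ?q t" by (rule eventually_mono[rotated]) auto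
qed

text \<open>How admissibility is used. The difference \<open>h = A\<^sup>p - c B\<^sup>p\<close> is convex and vanishes at \<open>0\<close>, which
  lies between \<open>y\<close> and \<open>- s y\<close>; hence \<open>h(y) \<ge> - h(- s y) / s\<close>. Since
  \<open>h(- s y) \<le> A(- s y)\<^sup>p \<le> s\<^sup>p A(- y)\<^sup>p\<close>, this gives \<open>h(y) \<ge> - s\<^bsup>p-1\<^esup> A(- y)\<^sup>p\<close>, and the
  right-hand side tends to \<open>0\<close> with \<open>s\<close> because \<open>p > 1\<close>.\<close>

lemma powr_le_of_convex_diff:
  fixes A B :: "'a::real_vector \<Rightarrow> real"
  assumes p: "1 < p" and c: "0 < c" and A: "convex_on UNIV A" "A 0 = 0" "\<And>y. 0 \<le> A y"
    and B: "B 0 = 0"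
    and conv: "convex_on UNIV (\<lambda>y. A y powr p - c * B y powr p)"
  shows "c * B y powr p \<le> A y powr p"
proof -
  define h where "h y = A y powr p - c * B y powr p" for y
  have bound: "- (s powr (p - 1) * A (- y) powr p) \<le> h y" if s: "0 < s" "s < 1" for s
  proof -
    have "h ((1 - s / (1 + s)) *\<^sub>R (- s *\<^sub>R y) + (s / (1 + s)) *\<^sub>R y)
        \<le> (1 - s / (1 + s)) * h (- s *\<^sub>R y) + s / (1 + s) * h y"
      using conv s unfolding h_def by (intro convex_onD) (auto simp: field_simps)
    moreover have "(1 - s / (1 + s)) *\<^sub>R (- s *\<^sub>R y) + (s / (1 + s)) *\<^sub>R y
        = (s / (1 + s) - (1 - s / (1 + s)) * s) *\<^sub>R y"
      by (simp add: algebra_simps)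
    moreover have "s / (1 + s) - (1 - s / (1 + s)) * s = 0" "1 - s / (1 + s) = 1 / (1 + s)"
      using s by (auto simp: field_simps)
    moreover have "h 0 = 0" using p A B by (simp add: h_def)
    ultimately have "0 \<le> 1 / (1 + s) * h (- s *\<^sub>R y) + s / (1 + s) * h y" by simp
    then have "0 \<le> (1 + s) * (1 / (1 + s) * h (- s *\<^sub>R y) + s / (1 + s) * h y)" using s by simp
    also have "\<dots> = h (- s *\<^sub>R y) + s * h y" using s by (simp add: distrib_left)
    finally have "0 \<le> h (- s *\<^sub>R y) + s * h y" .
    moreover have "h (- s *\<^sub>R y) \<le> (s * A (- y)) powr p"
    proof -
      have "A ((1 - s) *\<^sub>R 0 + s *\<^sub>R (- y)) \<le> (1 - s) * A 0 + s * A (- y)"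
        using A(1) s by (intro convex_onD) auto
      then have "A (- s *\<^sub>R y) powr p \<le> (s * A (- y)) powr p"
        using A p by (intro powr_mono2) auto
      moreover have "0 \<le> c * B (- s *\<^sub>R y) powr p" using c by simp
      ultimately show ?thesis by (simp add: h_def)
    qed
    moreover have "(s * A (- y)) powr p = s * (s powr (p - 1) * A (- y) powr p)"
      using s A powr_mult_base[of s "p - 1"] by (simp add: powr_mult)
    ultimately have "0 \<le> s * (s powr (p - 1) * A (- y) powr p + h y)"
      by (simp add: algebra_simps)
    then show ?thesis using s by (simp add: zero_le_mult_iff)
  qed
  have "((\<lambda>s. - (s powr (p - 1) * A (- y) powr p)) \<longlongrightarrow> - (0 powr (p - 1) * A (- y) powr p)) (at_right 0)"
    using p by (intro tendsto_intros) (auto simp: eventually_at_right_field intro!: exI[of _ 1])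
  moreover have "\<forall>\<^sub>F s in at_right 0. - (s powr (p - 1) * A (- y) powr p) \<le> h y"
    using bound by (auto simp: eventually_at_right_field intro!: exI[of _ 1])
  ultimately have "- (0 powr (p - 1) * A (- y) powr p) \<le> h y"
    by (rule tendsto_upperbound) simp
  then show ?thesis by (simp add: h_def)
qed

section \<open>Integrals of log-concave functions and Pratt's lemma\<close>

lemma nn_integral_lborel_scaleR:
  fixes h :: "'a::euclidean_space \<Rightarrow> ennreal"
  assumes [measurable]: "h \<in> borel_measurable borel" and c: "0 < c"
  shows "(\<integral>\<^sup>+x. h (c *\<^sub>R x) \<partial>lborel) = ennreal (inverse c ^ DIM('a)) * (\<integral>\<^sup>+x. h x \<partial>lborel)"
proof -
  have "(\<integral>\<^sup>+x. h x \<partial>lborel)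
      = (\<integral>\<^sup>+x. h x \<partial>density (distr lborel borel (\<lambda>x. 0 + c *\<^sub>R x)) (\<lambda>_. \<bar>c\<bar> ^ DIM('a)))"
    using c lborel_affine[of c "0::'a"] by simp
  also have "\<dots> = ennreal (c ^ DIM('a)) * (\<integral>\<^sup>+x. h (c *\<^sub>R x) \<partial>lborel)"
    using c by (simp add: nn_integral_density nn_integral_distr nn_integral_cmult)
  finally show ?thesis
    using c by (simp add: mult.assoc[symmetric] power_mult_distrib[symmetric] flip: ennreal_mult')
qed

lemma has_bochner_integral_lborel_scaleR:
  fixes h :: "'a::euclidean_space \<Rightarrow> real"
  assumes h: "integrable lborel h" "\<And>x. 0 \<le> h x" and c: "0 < c"
  shows "has_bochner_integral lborel (\<lambda>x. h (c *\<^sub>R x)) (inverse c ^ DIM('a) * (LINT x|lborel. h x))"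
proof (rule has_bochner_integral_nn_integral)
  have [measurable]: "h \<in> borel_measurable borel"
    using borel_measurable_integrable[OF h(1)] by simp
  show "(\<lambda>x. h (c *\<^sub>R x)) \<in> borel_measurable lborel" by measurable
  show "(\<integral>\<^sup>+x. ennreal (h (c *\<^sub>R x)) \<partial>lborel) = ennreal (inverse c ^ DIM('a) * (LINT x|lborel. h x))"
    using nn_integral_lborel_scaleR[of "\<lambda>x. ennreal (h x)", OF _ c]
      nn_integral_eq_integral[OF h(1)] h(2) c
    by (simp add: ennreal_mult)
qed (use h c in auto)

text \<open>Convexity and \<open>a 0 = 0\<close> give \<open>2 a(x) \<le> a(2 x)\<close>. So if \<open>I r\<close> is the integral over the ball of
  radius \<open>r\<close> and \<open>N = 2\<^sup>n\<close>, the substitution \<open>x \<mapsto> 2 x\<close> bounds \<open>I (2 r)\<close> by \<open>N\<close> times the integral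
  of \<open>exp (- a)\<^sup>2\<close> over the ball of radius \<open>r\<close>. Outside a fixed ball \<open>exp (- a) \<le> 1 / (2 N)\<close>, hence
  \<open>I r \<le> I (2 r) \<le> N B + I r / 2\<close> with a constant \<open>B\<close>, which bounds \<open>I r\<close> uniformly in \<open>r\<close>.\<close>

lemma integrable_exp_neg_convex:
  fixes a :: "'a::euclidean_space \<Rightarrow> real"
  assumes conv: "convex_on UNIV a" and a0: "a 0 = 0" and coercive: "filterlim a at_top at_infinity"
  shows "integrable lborel (\<lambda>x. exp (- a x))"
proof -
  have cont: "continuous_on UNIV a" by (intro convex_on_continuous conv) auto
  then have [measurable]: "a \<in> borel_measurable borel"
    by (rule borel_measurable_continuous_onI)
  define N where "N = (2::real) ^ DIM('a)"
  have N: "0 < N" by (simp add: N_def)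
  have "\<forall>\<^sub>F x in at_infinity. ln (2 * N) \<le> a x"
    using coercive by (simp add: filterlim_at_top)
  then obtain R where R: "\<And>x. R \<le> norm x \<Longrightarrow> ln (2 * N) \<le> a x"
    unfolding eventually_at_infinity by blast
  have dbl: "2 * a x \<le> a (2 *\<^sub>R x)" for x
    using convex_onD[OF conv, of "1/2" 0 "2 *\<^sub>R x"] a0 by simp
  have fin: "(\<integral>\<^sup>+x. ennreal (exp (- c * a x)) * indicator (cball 0 r) x \<partial>lborel) < top" for c r
  proof -
    have "continuous_on (cball 0 r) (\<lambda>x. exp (- c * a x))"
      by (intro continuous_intros continuous_on_subset[OF cont]) auto
    then have "integrable lborel (\<lambda>x. indicator (cball 0 r) x *\<^sub>R exp (- c * a x))"
      by (intro borel_integrable_compact) auto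
    then have "(\<integral>\<^sup>+x. ennreal (norm (indicator (cball 0 r) x *\<^sub>R exp (- c * a x))) \<partial>lborel) < top"
      by (simp add: integrable_iff_bounded)
    moreover have "ennreal (norm (indicator (cball 0 r) x *\<^sub>R exp (- c * a x)))
        = ennreal (exp (- c * a x)) * indicator (cball 0 r) x" for x
      by (auto split: split_indicator)
    ultimately show ?thesis by simp
  qed
  have meas: "(\<lambda>x. ennreal (exp (- c * a x)) * indicator (cball 0 r) x) \<in> borel_measurable borel" for c r
    by (intro borel_measurable_times_ennreal borel_measurable_indicator) auto
  from meas[of 1] have meas1: "(\<lambda>x. ennreal (exp (- a x)) * indicator (cball 0 r) x) \<in> borel_measurable borel" for r
    by simp
  define B where "B = (\<integral>\<^sup>+x. ennreal (exp (- 2 * a x)) * indicator (cball 0 R) x \<partial>lborel)"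
  have B: "B < top" unfolding B_def by (rule fin)
  define I where "I r = (\<integral>\<^sup>+x. ennreal (exp (- a x)) * indicator (cball 0 r) x \<partial>lborel)" for r
  have I_fin: "I r < top" for r
    using fin[of 1 r] by (simp add: I_def)
  have step: "I r \<le> ennreal N * B + ennreal (1 / 2) * I r" if "0 \<le> r" for r
  proof -
    have "I r \<le> I (2 * r)"
      unfolding I_def using that by (intro nn_integral_mono) (auto split: split_indicator)
    also have "I (2 * r) = ennreal N * (\<integral>\<^sup>+x. ennreal (exp (- a (2 *\<^sub>R x))) * indicator (cball 0 (2 * r)) (2 *\<^sub>R x) \<partial>lborel)"
    proof -
      have scale: "ennreal N * (ennreal (inverse 2 ^ DIM('a)) * I (2 * r)) = I (2 * r)"
        using N by (simp add: N_def mult.assoc[symmetric] flip: ennreal_mult' power_mult_distrib)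
      have "(\<integral>\<^sup>+x. ennreal (exp (- a (2 *\<^sub>R x))) * indicator (cball 0 (2 * r)) (2 *\<^sub>R x) \<partial>lborel)
          = ennreal (inverse 2 ^ DIM('a)) * I (2 * r)"
        unfolding I_def by (rule nn_integral_lborel_scaleR[OF meas1]) simp
      with scale show ?thesis by (simp only:)
    qed
    also have "\<dots> \<le> ennreal N * (\<integral>\<^sup>+x. (ennreal (exp (- 2 * a x)) * indicator (cball 0 R) x
        + ennreal (1 / (2 * N)) * (ennreal (exp (- a x)) * indicator (cball 0 r) x)) \<partial>lborel)"
    proof (intro mult_left_mono nn_integral_mono)
      fix x :: 'a
      show "ennreal (exp (- a (2 *\<^sub>R x))) * indicator (cball 0 (2 * r)) (2 *\<^sub>R x)
          \<le> ennreal (exp (- 2 * a x)) * indicator (cball 0 R) x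
            + ennreal (1 / (2 * N)) * (ennreal (exp (- a x)) * indicator (cball 0 r) x)"
      proof (cases "norm x \<le> r")
        case True
        show ?thesis
        proof (cases "norm x \<le> R")
          case True
          then show ?thesis using dbl[of x]
            by (auto split: split_indicator intro!: add_increasing2)
        next
          case False
          have "exp (- a (2 *\<^sub>R x)) \<le> exp (- 2 * a x)" using dbl[of x] by simp
          also have "\<dots> = exp (- a x) * exp (- a x)" by (simp flip: exp_add)
          also have "\<dots> \<le> exp (- ln (2 * N)) * exp (- a x)"
            using R[of x] False by (intro mult_right_mono) auto
          also have "exp (- ln (2 * N)) = 1 / (2 * N)"
            using N by (simp add: exp_minus inverse_eq_divide)
          finally have "ennreal (exp (- a (2 *\<^sub>R x))) \<le> ennreal (1 / (2 * N) * exp (- a x))"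
            by (rule ennreal_leI)
          also have "\<dots> = ennreal (1 / (2 * N)) * ennreal (exp (- a x))"
            using N by (intro ennreal_mult) auto
          finally show ?thesis using True False by (simp split: split_indicator)
        qed
      qed (auto split: split_indicator)
    qed auto
    also have "\<dots> = ennreal N * (B + ennreal (1 / (2 * N)) * I r)"
      unfolding B_def I_def
      by (subst nn_integral_add) (simp_all add: nn_integral_cmult meas[of 2, simplified] meas1
          borel_measurable_times_ennreal[OF borel_measurable_const meas1])
    also have "\<dots> = ennreal N * B + ennreal (1 / 2) * I r"
      using N by (simp add: distrib_left mult.assoc[symmetric] flip: ennreal_mult')
    finally show ?thesis .
  qed
  have "ennreal N * B < top" using B by (simp add: ennreal_mult_less_top)
  then obtain b where b: "0 \<le> b" "ennreal N * B = ennreal b"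
    by (cases "ennreal N * B" rule: ennreal_cases) auto
  have I_le: "I (real k) \<le> ennreal (2 * b)" for k
  proof -
    obtain i where i: "0 \<le> i" "I (real k) = ennreal i"
      using I_fin[of "real k"] by (cases "I (real k)" rule: ennreal_cases) auto
    with step[of "real k"] b have "ennreal i \<le> ennreal (b + 1 / 2 * i)"
      by (subst ennreal_plus, simp_all only: ennreal_mult')
    then have "i \<le> b + 1 / 2 * i"
      by (rule ennreal_le_iff[THEN iffD1, rotated]) (use b i in simp)
    with i show ?thesis by (simp add: ennreal_leI)
  qed
  have "(\<integral>\<^sup>+x. ennreal (exp (- a x)) \<partial>lborel) = (\<integral>\<^sup>+x. (SUP k. ennreal (exp (- a x)) * indicator (cball 0 (real k)) x) \<partial>lborel)"
  proof (rule nn_integral_cong)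
    fix x :: 'a
    obtain k where "norm x \<le> real k" using real_arch_simple by blast
    then have "ennreal (exp (- a x)) \<le> (SUP k. ennreal (exp (- a x)) * indicator (cball 0 (real k)) x)"
      by (intro SUP_upper2[of k]) auto
    moreover have "(SUP k. ennreal (exp (- a x)) * indicator (cball 0 (real k)) x) \<le> ennreal (exp (- a x))"
      by (intro SUP_least) (auto split: split_indicator)
    ultimately show "ennreal (exp (- a x)) = (SUP k. ennreal (exp (- a x)) * indicator (cball 0 (real k)) x)"
      by (rule antisym)
  qed
  also have "\<dots> = (SUP k. I (real k))"
    unfolding I_def
    by (intro nn_integral_monotone_convergence_SUP)
       (auto simp: incseq_def le_fun_def meas1 split: split_indicator)
  also have "\<dots> \<le> ennreal (2 * b)" using I_le by (intro SUP_least)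
  finally show ?thesis
    by (auto simp: integrable_iff_bounded intro: le_less_trans)
qed

text \<open>Integration by parts without boundary terms. With \<open>k(x) = \<langle>x, D x\<rangle> exp (- a x)\<close> and \<open>K\<close> its
  integral, integrating \<open>k(r x) / r\<close> over \<open>r\<close> from \<open>1\<close> to \<open>2\<close> gives \<open>exp (- a x) - exp (- a (2 x))\<close>. The
  integral of this over \<open>x\<close> is \<open>(1 - 2\<^bsup>-n\<^esup>) J\<close> by scaling; integrating over \<open>x\<close> first gives
  \<open>K\<close> times the integral of \<open>r\<^bsup>-n-1\<^esup>\<close>, that is \<open>K (1 - 2\<^bsup>-n\<^esup>) / n\<close>. Everything is nonnegative, so
  Tonelli's theorem applies and yields finiteness of \<open>K\<close> as well.\<close>

lemma integral_inner_gradient_exp_neg: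
  fixes a :: "'a::euclidean_space \<Rightarrow> real"
  assumes int: "integrable lborel (\<lambda>x. exp (- a x))"
    and grad: "\<And>x. GDERIV a x :> D x" and cont: "continuous_on UNIV D"
    and nonneg: "\<And>x. 0 \<le> x \<bullet> D x"
  shows "has_bochner_integral lborel (\<lambda>x. x \<bullet> D x * exp (- a x))
           (real DIM('a) * (LINT x|lborel. exp (- a x)))"
proof -
  define n where "n = DIM('a)"
  have n: "0 < n" by (simp add: n_def)
  define J where "J = (LINT x|lborel. exp (- a x))"
  have J: "0 \<le> J" by (simp add: J_def)
  define k where "k x = x \<bullet> D x * exp (- a x)" for x
  have a_der: "(a has_derivative (\<lambda>h. h \<bullet> D x)) (at x)" for x
    using grad by (simp add: gderiv_def)
  have cont_a: "continuous_on UNIV a"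
    using has_derivative_continuous[OF a_der] by (auto simp: continuous_on_eq_continuous_at)
  have [measurable]: "a \<in> borel_measurable borel" "D \<in> borel_measurable borel"
    using cont cont_a by (auto intro: borel_measurable_continuous_onI)
  have k_meas [measurable]: "k \<in> borel_measurable borel" unfolding k_def by measurable
  have k_nonneg: "0 \<le> k x" for x using nonneg by (simp add: k_def)
  define K where "K = (\<integral>\<^sup>+x. ennreal (k x) \<partial>lborel)"
  define \<alpha> where "\<alpha> = (1 - inverse 2 ^ n) / real n"
  have \<alpha>: "0 < \<alpha>" using n by (auto simp: \<alpha>_def power_less_one_iff)
  have ray_deriv: "((\<lambda>r. - exp (- a (r *\<^sub>R x))) has_real_derivative
      x \<bullet> D (r *\<^sub>R x) * exp (- a (r *\<^sub>R x))) (at r)" for x r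
  proof -
    have "((\<lambda>r. a (r *\<^sub>R x)) has_derivative (\<lambda>h. (h *\<^sub>R x) \<bullet> D (r *\<^sub>R x))) (at r)"
      by (rule has_derivative_compose[OF _ a_der]) (auto intro!: derivative_eq_intros)
    then have "((\<lambda>r. a (r *\<^sub>R x)) has_field_derivative x \<bullet> D (r *\<^sub>R x)) (at r)"
      by (rule has_derivative_imp_has_field_derivative) simp
    then show ?thesis
      by (auto intro!: derivative_eq_intros)
  qed
  have ray_nonneg: "0 \<le> x \<bullet> D (r *\<^sub>R x) * exp (- a (r *\<^sub>R x))" if "1 \<le> r" for x r
    using nonneg[of "r *\<^sub>R x"] that by (auto simp: zero_le_mult_iff)
  have ray: "(\<integral>\<^sup>+r. ennreal (x \<bullet> D (r *\<^sub>R x) * exp (- a (r *\<^sub>R x))) * indicator {1..2} r \<partial>lborel)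
      = ennreal (exp (- a x) - exp (- a (2 *\<^sub>R x)))" for x
  proof -
    have "(\<integral>\<^sup>+r. ennreal (x \<bullet> D (r *\<^sub>R x) * exp (- a (r *\<^sub>R x))) * indicator {1..2} r \<partial>lborel)
       = ennreal (- exp (- a (2 *\<^sub>R x)) - - exp (- a (1 *\<^sub>R x)))"
      by (rule nn_integral_FTC_Icc) (use ray_deriv ray_nonneg in auto)
    then show ?thesis by simp
  qed
  have rad: "(\<integral>\<^sup>+r. ennreal (inverse r ^ (n + 1)) * indicator {1..2} r \<partial>lborel) = ennreal \<alpha>"
  proof -
    have "(\<integral>\<^sup>+r. ennreal (inverse r ^ (n + 1)) * indicator {1..2} r \<partial>lborel)
       = ennreal (- (inverse 2 ^ n) / real n - - (inverse 1 ^ n) / real n)"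
    proof (rule nn_integral_FTC_Icc)
      fix r :: real assume "r \<in> {1..2}"
      then have r: "r \<noteq> 0" "0 < r" by auto
      have "inverse r ^ (n - Suc 0) * (inverse r * inverse r) = inverse r ^ (n + 1)"
        using n by (cases n) (auto simp: mult_ac)
      with r n show "((\<lambda>r. - (inverse r ^ n) / real n) has_real_derivative inverse r ^ (n + 1)) (at r)"
        by (auto intro!: derivative_eq_intros simp: field_simps)
      show "0 \<le> inverse r ^ (n + 1)" using r by simp
    qed auto
    then show ?thesis by (simp add: \<alpha>_def diff_divide_distrib)
  qed
  have "ennreal ((1 - inverse 2 ^ n) * J)
      = (\<integral>\<^sup>+x. ennreal (exp (- a x) - exp (- a (2 *\<^sub>R x))) \<partial>lborel)"
  proof -
    have "has_bochner_integral lborel (\<lambda>x. exp (- a x) - exp (- a (2 *\<^sub>R x))) (J - inverse 2 ^ n * J)"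
      unfolding n_def J_def
      by (intro has_bochner_integral_diff has_bochner_integral_lborel_scaleR[of "\<lambda>x. exp (- a x)" 2]
          has_bochner_integral_integrable int) auto
    moreover have "0 \<le> exp (- a x) - exp (- a (2 *\<^sub>R x))" for x
      using DERIV_nonneg_imp_nondecreasing[of 1 2 "\<lambda>r. - exp (- a (r *\<^sub>R x))"]
        ray_deriv ray_nonneg by fastforce
    ultimately show ?thesis
      by (simp add: nn_integral_eq_integral has_bochner_integral_iff left_diff_distrib)
  qed
  also have "\<dots> = (\<integral>\<^sup>+x. \<integral>\<^sup>+r. ennreal (inverse r * k (r *\<^sub>R x)) * indicator {1..2} r \<partial>lborel \<partial>lborel)"
    unfolding ray[symmetric] k_def
    by (intro nn_integral_cong) (simp add: mult.assoc[symmetric] split: split_indicator)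
  also have "\<dots> = (\<integral>\<^sup>+r. \<integral>\<^sup>+x. ennreal (inverse r * k (r *\<^sub>R x)) * indicator {1..2} r \<partial>lborel \<partial>lborel)"
    by (rule lborel_pair.Fubini') measurable
  also have "\<dots> = (\<integral>\<^sup>+r. ennreal (inverse r ^ (n + 1)) * indicator {1..2} r * K \<partial>lborel)"
  proof (rule nn_integral_cong)
    fix r :: real
    show "(\<integral>\<^sup>+x. ennreal (inverse r * k (r *\<^sub>R x)) * indicator {1..2} r \<partial>lborel)
        = ennreal (inverse r ^ (n + 1)) * indicator {1..2} r * K"
    proof (cases "r \<in> {1..2}")
      case True
      then have "(\<integral>\<^sup>+x. ennreal (inverse r * k (r *\<^sub>R x)) \<partial>lborel)
          = ennreal (inverse r) * (ennreal (inverse r ^ n) * K)"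
        unfolding K_def n_def
        by (subst nn_integral_lborel_scaleR[symmetric])
           (auto simp: ennreal_mult k_nonneg intro!: nn_integral_cmult)
      with True show ?thesis by (simp add: ennreal_mult mult.assoc)
    qed auto
  qed
  also have "\<dots> = ennreal \<alpha> * K"
    by (subst nn_integral_multc) (simp_all only: rad, measurable)
  finally have eq: "ennreal \<alpha> * K = ennreal ((1 - inverse 2 ^ n) * J)" ..
  have "K = ennreal (inverse \<alpha>) * (ennreal \<alpha> * K)"
    using \<alpha> by (simp add: mult.assoc[symmetric] flip: ennreal_mult')
  also have "\<dots> = ennreal (inverse \<alpha> * ((1 - inverse 2 ^ n) * J))"
    using \<alpha> by (simp add: eq ennreal_mult')
  also have "inverse \<alpha> * ((1 - inverse 2 ^ n) * J) = real n * J"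
    using \<alpha> n by (auto simp: \<alpha>_def)
  finally have "K = ennreal (real n * J)" .
  then show ?thesis
    unfolding n_def J_def K_def k_def
    by (intro has_bochner_integral_nn_integral) (use nonneg J in \<open>auto simp: J_def\<close>)
qed

text \<open>The truncations \<open>min (un n) v\<close> are dominated by \<open>v\<close>; what they cut off is at most
  \<open>vn n - min (vn n) v\<close>, whose integral tends to \<open>0\<close>.\<close>

lemma Pratt_dominated_convergence:
  fixes u v :: "'a \<Rightarrow> real" and un vn :: "nat \<Rightarrow> 'a \<Rightarrow> real"
  assumes int: "\<And>n. integrable M (vn n)" "integrable M v"
    and [measurable]: "\<And>n. un n \<in> borel_measurable M" "u \<in> borel_measurable M"
    and lim: "AE x in M. (\<lambda>n. un n x) \<longlonglongrightarrow> u x" "AE x in M. (\<lambda>n. vn n x) \<longlonglongrightarrow> v x"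
    and le: "\<And>n. AE x in M. 0 \<le> un n x \<and> un n x \<le> vn n x"
    and lim_int: "(\<lambda>n. LINT x|M. vn n x) \<longlonglongrightarrow> (LINT x|M. v x)"
  shows "integrable M u" and "(\<lambda>n. LINT x|M. un n x) \<longlonglongrightarrow> (LINT x|M. u x)"
proof -
  have [measurable]: "\<And>n. vn n \<in> borel_measurable M" "v \<in> borel_measurable M"
    using int by auto
  have le': "AE x in M. \<forall>n. 0 \<le> un n x \<and> un n x \<le> vn n x"
    using le by (simp add: AE_all_countable)
  have uv: "AE x in M. 0 \<le> u x \<and> u x \<le> v x"
    using lim le'
  proof eventually_elim
    case (elim x)
    then show ?case by (auto intro: LIMSEQ_le LIMSEQ_le_const)
  qed
  show int_u: "integrable M u"
    by (rule Bochner_Integration.integrable_bound[OF int(2)]) (use uv in auto)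
  have int_un: "integrable M (un n)" for n
    by (rule Bochner_Integration.integrable_bound[OF int(1)[of n]]) (use le[of n] in auto)
  have mv: "(\<lambda>n. LINT x|M. min (vn n x) (v x)) \<longlonglongrightarrow> (LINT x|M. v x)"
  proof (rule integral_dominated_convergence[where w = v])
    show "AE x in M. (\<lambda>n. min (vn n x) (v x)) \<longlonglongrightarrow> v x"
      using lim(2)
    proof eventually_elim
      case (elim x)
      from tendsto_min[OF elim tendsto_const[of "v x"]] show ?case by simp
    qed
    show "AE x in M. norm (min (vn n x) (v x)) \<le> v x" for n
      using le[of n] uv by eventually_elim auto
  qed (use int in auto)
  have mu: "(\<lambda>n. LINT x|M. min (un n x) (v x)) \<longlonglongrightarrow> (LINT x|M. u x)"
  proof (rule integral_dominated_convergence[where w = v])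
    show "AE x in M. (\<lambda>n. min (un n x) (v x)) \<longlonglongrightarrow> u x"
      using lim(1) uv
    proof eventually_elim
      case (elim x)
      from tendsto_min[OF elim(1) tendsto_const[of "v x"]] elim(2) show ?case by (simp add: min_absorb1)
    qed
    show "AE x in M. norm (min (un n x) (v x)) \<le> v x" for n
      using le[of n] uv by eventually_elim auto
  qed (use int in auto)
  have "(\<lambda>n. (LINT x|M. vn n x) - (LINT x|M. min (vn n x) (v x))) \<longlonglongrightarrow> 0"
    using tendsto_diff[OF lim_int mv] by simp
  then have "(\<lambda>n. (LINT x|M. un n x) - (LINT x|M. min (un n x) (v x))) \<longlonglongrightarrow> 0"
  proof (rule tendsto_sandwich[OF _ _ tendsto_const, rotated -1])
    show "\<forall>\<^sub>F n in sequentially. 0 \<le> (LINT x|M. un n x) - (LINT x|M. min (un n x) (v x))"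
      using int int_un by (auto intro!: always_eventually integral_mono)
    have "(LINT x|M. un n x) - (LINT x|M. min (un n x) (v x))
        \<le> (LINT x|M. vn n x) - (LINT x|M. min (vn n x) (v x))" for n
    proof -
      have "(LINT x|M. un n x - min (un n x) (v x)) \<le> (LINT x|M. vn n x - min (vn n x) (v x))"
        using le[of n] int int_un by (intro integral_mono_AE) auto
      then show ?thesis using int int_un by simp
    qed
    then show "\<forall>\<^sub>F n in sequentially. (LINT x|M. un n x) - (LINT x|M. min (un n x) (v x))
        \<le> (LINT x|M. vn n x) - (LINT x|M. min (vn n x) (v x))" by simp
  qed
  from tendsto_add[OF this mu] show "(\<lambda>n. LINT x|M. un n x) \<longlonglongrightarrow> (LINT x|M. u x)" by simp
qed

section \<open>The first variation of the total mass\<close>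

lemma tendsto_exp_neg_diff_quotient:
  fixes h :: "real \<Rightarrow> real"
  assumes h: "((\<lambda>t. (\<alpha> - h t) / t) \<longlongrightarrow> L) (at_right 0)"
  shows "((\<lambda>t. (exp (- h t) - exp (- \<alpha>)) / t) \<longlongrightarrow> L * exp (- \<alpha>)) (at_right 0)"
proof -
  define g where "g s = (if s = 0 then 1 else (exp s - 1) / s)" for s :: real
  have exp_g: "exp s - 1 = s * g s" for s by (simp add: g_def)
  have "((\<lambda>s. (exp s - 1) / s) \<longlongrightarrow> 1) (at (0::real))"
    using DERIV_exp[of "0::real"] by (simp add: DERIV_def)
  then have "(g \<longlongrightarrow> 1) (at 0)"
    by (rule Lim_transform_eventually) (auto simp: g_def eventually_at_filter)
  then have "isCont g 0" by (simp add: isCont_def g_def)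
  moreover have "((\<lambda>t. \<alpha> - h t) \<longlongrightarrow> 0) (at_right 0)"
  proof (rule Lim_transform_eventually)
    show "((\<lambda>t. t * ((\<alpha> - h t) / t)) \<longlongrightarrow> 0) (at_right 0)"
      using tendsto_mult[OF tendsto_ident_at h] by (simp only: mult_zero_left)
  qed (auto simp: eventually_at_filter)
  ultimately have "((\<lambda>t. g (\<alpha> - h t)) \<longlongrightarrow> g 0) (at_right 0)"
    by (rule isCont_tendsto_compose)
  then have "((\<lambda>t. (\<alpha> - h t) / t * g (\<alpha> - h t) * exp (- \<alpha>)) \<longlongrightarrow> L * g 0 * exp (- \<alpha>)) (at_right 0)"
    by (intro tendsto_mult h tendsto_const)
  moreover have "(\<alpha> - h t) / t * g (\<alpha> - h t) * exp (- \<alpha>) = (exp (- h t) - exp (- \<alpha>)) / t" for t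
  proof -
    have "exp (- h t) - exp (- \<alpha>) = (exp (\<alpha> - h t) - 1) * exp (- \<alpha>)"
      by (simp add: left_diff_distrib flip: exp_add)
    then show ?thesis by (simp add: exp_g)
  qed
  moreover have "g 0 = 1" by (simp add: g_def)
  ultimately show ?thesis by (simp only: mult_1_right)
qed

text \<open>The analytic core. In the proof, \<open>pert t\<close> is the perturbed potential, \<open>U t\<close> the difference
  quotient of its exponential with limit \<open>u\<close>, and \<open>V t\<close> the dominating quotient with limit \<open>v\<close>.\<close>

lemma Lp_variation_exp_neg:
  fixes a b :: "'a::euclidean_space \<Rightarrow> real"
  defines "A \<equiv> conjugate a" and "B \<equiv> conjugate b"
  assumes p: "1 < p"
    and conv: "convex_on UNIV a" and a0: "a 0 = 0" and a_nonneg: "\<And>x. 0 \<le> a x"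
    and coercive: "filterlim a at_top at_infinity"
    and grad: "\<And>x. GDERIV a x :> D x" and cont_D: "continuous_on UNIV D"
    and strict: "\<And>x. x \<noteq> 0 \<Longrightarrow> a x < x \<bullet> D x"
    and bdd_a: "\<And>y. bdd_above (range (\<lambda>x. x \<bullet> y - a x))"
    and bdd_b: "\<And>y. bdd_above (range (\<lambda>x. x \<bullet> y - b x))" and b0: "b 0 = 0"
    and c: "0 < c" and le: "\<And>y. c * B y powr p \<le> A y powr p"
  shows "integrable lborel (\<lambda>x. B (D x) powr p * A (D x) powr (1 - p) * exp (- a x))" (is ?int)
    and "((\<lambda>t. ((LINT x|lborel. exp (- conjugate (\<lambda>y. Lp_comb p t (A y) (B y)) x))
              - (LINT x|lborel. exp (- a x))) / t)
          \<longlongrightarrow> 1 / p * (LINT x|lborel. B (D x) powr p * A (D x) powr (1 - p) * exp (- a x)))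
        (at_right 0)" (is ?lim)
proof -
  define pert where "pert t = conjugate (\<lambda>y. Lp_comb p t (A y) (B y))" for t
  define l where "l t = (1 + t / c) powr (1 / p)" for t
  define J where "J = (LINT x|lborel. exp (- a x))"
  define u where "u x = 1 / p * (B (D x) powr p * A (D x) powr (1 - p)) * exp (- a x)" for x
  define v where "v x = 1 / (p * c) * (x \<bullet> D x * exp (- a x))" for x
  define U where "U t x = (exp (- pert t x) - exp (- a x)) / t" for t x
  define V where "V t x = (exp (- a (inverse (l t) *\<^sub>R x)) - exp (- a x)) / t" for t x

  have A_nonneg: "0 \<le> A y" and B_nonneg: "0 \<le> B y" for y
    unfolding A_def B_def by (intro conjugate_nonneg bdd_a bdd_b a0 b0)+
  have A_upper: "x \<bullet> y - a x \<le> A y" for x y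
    unfolding A_def by (intro conjugate_upper bdd_a)
  have Fenchel: "A (D x) = x \<bullet> D x - a x" for x
    unfolding A_def by (intro Fenchel_equality conv grad)
  have cont: "continuous_on UNIV A" "continuous_on UNIV B" "continuous_on UNIV a"
    unfolding A_def B_def
    by (intro convex_on_continuous convex_conjugate bdd_a bdd_b conv; simp)+
  have [measurable]: "A \<in> borel_measurable borel" "B \<in> borel_measurable borel"
    "a \<in> borel_measurable borel" "D \<in> borel_measurable borel"
    using cont cont_D by (auto intro: borel_measurable_continuous_onI)
  have bdd_pert: "bdd_above (range (\<lambda>y. y \<bullet> x - Lp_comb p t (A y) (B y)))" if "0 \<le> t" for t x
    by (rule bdd_above_conjugate_Lp_comb[OF p that A_upper A_nonneg])
  have pert_measurable: "pert t \<in> borel_measurable borel" if "0 < t" for t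
    unfolding pert_def using that
    by (intro borel_measurable_continuous_onI convex_on_continuous convex_conjugate bdd_pert) auto
  have inner_nonneg: "0 \<le> x \<bullet> D x" for x
    using strict[of x] a_nonneg[of x] by (cases "x = 0") auto

  have l_ge_1: "1 \<le> l t" if "0 \<le> t" for t
    using that c p by (auto simp: l_def intro!: ge_one_powr_ge_zero)
  have l_deriv: "(l has_real_derivative 1 / (p * c)) (at 0)"
    unfolding l_def using c p by (auto intro!: derivative_eq_intros)
  have l0: "l 0 = 1" by (simp add: l_def)

  have pert_le: "pert t x \<le> a x" if "0 < t" for t x
    unfolding pert_def using that
    by (intro conjugate_least bdd_above_conjugate_Lp_comb[OF p _ A_upper A_nonneg]) auto
  \<comment> \<open>The domination of the \<open>p\<close>-th powers gives \<open>Lp_comb p t A B \<le> l t * A\<close>; testing the perturbed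
    supremum at the gradient at \<open>x / l t\<close>, where Fenchel's inequality is an equality, yields
    \<open>l t * a (x / l t) \<le> pert t x\<close>.\<close>
  have pert_ge: "a (inverse (l t) *\<^sub>R x) \<le> pert t x" if t: "0 < t" for t x
  proof -
    define z where "z = inverse (l t) *\<^sub>R x"
    have l: "1 \<le> l t" using l_ge_1 t by simp
    have "Lp_comb p t (A (D z)) (B (D z)) \<le> ((1 + t / c) * A (D z) powr p) powr (1 / p)"
      unfolding Lp_comb_def
      using p t c le[of "D z"] by (intro powr_mono2) (auto simp: field_simps intro!: mult_left_mono)
    also have "\<dots> = l t * A (D z)"
      using p t c A_nonneg by (simp add: powr_mult powr_powr l_def)
    finally have "Lp_comb p t (A (D z)) (B (D z)) \<le> l t * A (D z)" .
    moreover have "l t * (z \<bullet> D z) = D z \<bullet> x"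
      using l by (simp add: z_def inner_commute)
    ultimately have "l t * (z \<bullet> D z - A (D z)) \<le> D z \<bullet> x - Lp_comb p t (A (D z)) (B (D z))"
      by (simp add: right_diff_distrib)
    also have "\<dots> \<le> pert t x"
      unfolding pert_def using t by (intro conjugate_upper bdd_pert) auto
    finally have "l t * a z \<le> pert t x" by (simp add: Fenchel)
    moreover have "1 * a z \<le> l t * a z" using l a_nonneg by (intro mult_right_mono) auto
    ultimately show ?thesis by (simp add: z_def)
  qed
  have U_bounds: "0 \<le> U t x" "U t x \<le> V t x" if "0 < t" for t x
    using that pert_le[OF that, of x] pert_ge[OF that, of x]
    by (auto simp: U_def V_def divide_right_mono)

  have int_a: "integrable lborel (\<lambda>x. exp (- a x))"
    by (intro integrable_exp_neg_convex conv a0 coercive)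
  have scaled: "has_bochner_integral lborel (\<lambda>x. exp (- a (inverse (l t) *\<^sub>R x))) (l t ^ DIM('a) * J)"
    if "0 < t" for t
    using has_bochner_integral_lborel_scaleR[OF int_a, of "inverse (l t)"] l_ge_1[of t] that
    by (simp add: J_def)
  have int_V: "has_bochner_integral lborel (V t) ((l t ^ DIM('a) * J - J) / t)" if "0 < t" for t
    unfolding V_def J_def
    using that scaled[OF that] int_a
    by (intro has_bochner_integral_divide_zero has_bochner_integral_diff
        has_bochner_integral_integrable) (auto simp: J_def)
  have int_pert: "integrable lborel (\<lambda>x. exp (- pert t x))" if "0 < t" for t
  proof (rule Bochner_Integration.integrable_bound)
    show "integrable lborel (\<lambda>x. exp (- a (inverse (l t) *\<^sub>R x)))"
      using scaled[OF that] by (simp add: has_bochner_integral_iff)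
  qed (use pert_ge[OF that] pert_measurable[OF that] in auto)
  have int_v: "has_bochner_integral lborel v (1 / (p * c) * (real DIM('a) * J))"
    unfolding v_def J_def
    by (intro has_bochner_integral_mult_right integral_inner_gradient_exp_neg int_a grad cont_D
        inner_nonneg)

  have lim_U: "((\<lambda>t. U t x) \<longlongrightarrow> u x) (at_right 0)" if x: "x \<noteq> 0" for x
  proof -
    have "((\<lambda>t. (a x - pert t x) / t) \<longlongrightarrow> 1 / p * (B (D x) powr p * A (D x) powr (1 - p))) (at_right 0)"
      unfolding pert_def
      by (rule perturbed_conjugate_derivative[OF p A_upper A_nonneg grad Fenchel])
         (use strict[OF x] cont B_nonneg in \<open>auto simp: Fenchel continuous_on_eq_continuous_at\<close>)
    from tendsto_exp_neg_diff_quotient[OF this] show ?thesis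
      by (simp add: U_def u_def)
  qed
  have lim_V: "((\<lambda>t. V t x) \<longlongrightarrow> v x) (at_right 0)" for x
  proof -
    have a_der: "(a has_derivative (\<lambda>h. h \<bullet> D x)) (at (inverse (l 0) *\<^sub>R x))"
      using grad[of x] by (simp add: l0 gderiv_def)
    have "((\<lambda>t. inverse (l t)) has_real_derivative - (1 / (p * c))) (at 0)"
      using l_deriv by (auto intro!: derivative_eq_intros simp: l0)
    then have "((\<lambda>t. inverse (l t) *\<^sub>R x) has_derivative (\<lambda>h. (- (1 / (p * c)) * h) *\<^sub>R x)) (at 0)"
      unfolding has_field_derivative_def by (rule has_derivative_scaleR_left)
    from has_derivative_compose[OF this a_der]
    have "((\<lambda>t. a (inverse (l t) *\<^sub>R x)) has_field_derivative - (1 / (p * c) * (x \<bullet> D x))) (at 0)"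
      by (rule has_derivative_imp_has_field_derivative) simp
    then have "((\<lambda>t. a x - a (inverse (l t) *\<^sub>R x)) has_field_derivative 1 / (p * c) * (x \<bullet> D x)) (at 0)"
      by (auto intro!: derivative_eq_intros)
    then have "((\<lambda>t. (a x - a (inverse (l t) *\<^sub>R x)) / t) \<longlongrightarrow> 1 / (p * c) * (x \<bullet> D x)) (at_right 0)"
      by (auto simp: DERIV_def l0 intro: filterlim_mono[OF _ order_refl at_le])
    from tendsto_exp_neg_diff_quotient[OF this] show ?thesis
      by (simp add: V_def v_def)
  qed
  have lim_int_V: "((\<lambda>t. LINT x|lborel. V t x) \<longlongrightarrow> (LINT x|lborel. v x)) (at_right 0)"
  proof -
    have "((\<lambda>t. l t ^ DIM('a) * J) has_real_derivative 1 / (p * c) * (real DIM('a) * J)) (at 0)"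
      using l_deriv by (auto intro!: derivative_eq_intros simp: l0)
    then have "((\<lambda>t. (l t ^ DIM('a) * J - J) / t) \<longlongrightarrow> 1 / (p * c) * (real DIM('a) * J)) (at_right 0)"
      by (auto simp: DERIV_def l0 intro: filterlim_mono[OF _ order_refl at_le])
    then have "((\<lambda>t. LINT x|lborel. V t x) \<longlongrightarrow> 1 / (p * c) * (real DIM('a) * J)) (at_right 0)"
      by (rule Lim_transform_eventually)
         (use int_V in \<open>auto simp: eventually_at_filter has_bochner_integral_iff\<close>)
    then show ?thesis using int_v by (simp add: has_bochner_integral_iff)
  qed

  have seq: "integrable lborel u \<and> (\<lambda>i. LINT x|lborel. U (X i) x) \<longlonglongrightarrow> (LINT x|lborel. u x)"
    if X: "\<And>i. 0 < X i" "X \<longlonglongrightarrow> 0" for X :: "nat \<Rightarrow> real"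
  proof -
    have X': "filterlim X (at_right 0) sequentially"
      using X by (auto simp: filterlim_at less_imp_neq[symmetric] intro!: always_eventually)
    \<comment> \<open>At \<open>x = 0\<close> the conjugate vanishes at the gradient, so the pointwise limit of \<open>U\<close> is known
      only away from the origin.\<close>
    have "AE x in lborel. x \<noteq> (0::'a)" by (rule AE_lborel_singleton)
    then have U_u: "AE x in lborel. (\<lambda>i. U (X i) x) \<longlonglongrightarrow> u x"
      by eventually_elim (rule filterlim_compose[OF lim_U X'])
    have V_v: "AE x in lborel. (\<lambda>i. V (X i) x) \<longlonglongrightarrow> v x"
      by (intro AE_I2 filterlim_compose[OF lim_V X'])
    have int_V_v: "(\<lambda>i. LINT x|lborel. V (X i) x) \<longlonglongrightarrow> (LINT x|lborel. v x)"
      by (rule filterlim_compose[OF lim_int_V X'])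
    have V_int: "integrable lborel (V (X i))" for i
      using int_V[OF X(1)] by (simp add: has_bochner_integral_iff)
    have v_int: "integrable lborel v"
      using int_v by (simp add: has_bochner_integral_iff)
    have U_meas: "U (X i) \<in> borel_measurable lborel" for i
      using pert_measurable[OF X(1)[of i]] unfolding U_def by measurable
    have u_meas: "u \<in> borel_measurable lborel"
      unfolding u_def by measurable
    have U_V: "AE x in lborel. 0 \<le> U (X i) x \<and> U (X i) x \<le> V (X i) x" for i
      using U_bounds[OF X(1)] by simp
    show ?thesis
      using Pratt_dominated_convergence[OF V_int v_int U_meas u_meas U_u V_v U_V int_V_v] by blast
  qed
  have "(\<lambda>i. inverse (real (Suc i))) \<longlonglongrightarrow> 0" by (rule LIMSEQ_inverse_real_of_nat)
  then have int_u: "integrable lborel u" using seq[of "\<lambda>i. inverse (real (Suc i))"] by simp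
  then have "integrable lborel (\<lambda>x. p * u x)" by simp
  then show ?int using p by (simp add: u_def mult.assoc)
  have "((\<lambda>t. LINT x|lborel. U t x) \<longlongrightarrow> (LINT x|lborel. u x)) (at_right 0)"
    unfolding tendsto_at_iff_sequentially using seq by (auto simp: comp_def)
  moreover have "(LINT x|lborel. U t x) = ((LINT x|lborel. exp (- pert t x)) - J) / t" if "0 < t" for t
    using int_pert[OF that] int_a by (simp add: U_def J_def)
  ultimately have "((\<lambda>t. ((LINT x|lborel. exp (- pert t x)) - J) / t) \<longlongrightarrow> (LINT x|lborel. u x)) (at_right 0)"
    by (auto simp: eventually_at_filter elim!: Lim_transform_eventually)
  moreover have "(LINT x|lborel. u x) = 1 / p * (LINT x|lborel. B (D x) powr p * A (D x) powr (1 - p) * exp (- a x))"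
    unfolding u_def by (simp add: mult.assoc flip: integral_mult_right_zero)
  ultimately show ?lim by (simp add: pert_def J_def)
qed

section \<open>Transfer to extended-real-valued potentials\<close>

lemma GDERIV_grad:
  fixes \<phi> :: "real ^ 'n \<Rightarrow> ereal"
  assumes "(\<lambda>z. real_of_ereal (\<phi> z)) differentiable (at x)"
  shows "GDERIV (\<lambda>z. real_of_ereal (\<phi> z)) x :> grad \<phi> x"
proof -
  obtain L where L: "((\<lambda>z. real_of_ereal (\<phi> z)) has_derivative L) (at x)"
    using assms by (auto simp: differentiable_def)
  then have "linear L" by (rule has_derivative_linear)
  then have "L = (\<lambda>h. h \<bullet> adjoint L 1)"
    by (simp add: adjoint_works)
  with L have "GDERIV (\<lambda>z. real_of_ereal (\<phi> z)) x :> adjoint L 1"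
    by (simp add: gderiv_def)
  moreover have "d = e"
    if "GDERIV (\<lambda>z. real_of_ereal (\<phi> z)) x :> d" "GDERIV (\<lambda>z. real_of_ereal (\<phi> z)) x :> e" for d e
  proof -
    have "(\<lambda>h. h \<bullet> d) = (\<lambda>h. h \<bullet> e)"
      using that unfolding gderiv_def by (rule has_derivative_unique)
    then show ?thesis by (simp add: fun_eq_iff vector_eq_ldot)
  qed
  ultimately have "\<exists>!d. GDERIV (\<lambda>z. real_of_ereal (\<phi> z)) x :> d" by blast
  then show ?thesis unfolding grad_def by (rule theI')
qed

text \<open>The properties of a function in \<open>class_L0'\<close> that the argument needs, for its real-valued
  representative. Strict convexity enters through \<open>a x < x \<bullet> grad \<phi> x\<close>, which says that the
  conjugate is positive at the gradient: compare the value at \<open>x / 2\<close> with the tangent at \<open>x\<close>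
  and with the chord from \<open>0\<close> to \<open>x\<close>.\<close>

lemma class_L0'_real:
  fixes \<phi> :: "real ^ 'n \<Rightarrow> ereal"
  assumes \<phi>: "\<phi> \<in> class_L0'"
  defines "a \<equiv> \<lambda>x. real_of_ereal (\<phi> x)"
  shows "\<phi> = (\<lambda>x. ereal (a x))" "a 0 = 0" "0 \<le> a x" "convex_on UNIV a"
    "filterlim a at_top at_infinity" "GDERIV a x :> grad \<phi> x" "continuous_on UNIV (grad \<phi>)"
    "x \<noteq> 0 \<Longrightarrow> a x < x \<bullet> grad \<phi> x" "bdd_above (range (\<lambda>x. x \<bullet> y - a x))"
proof -
  have L0': "\<And>x. \<phi> x \<noteq> \<infinity>" "C1 \<phi>" "ereal_strictly_convex \<phi>"
    "((\<lambda>x. \<phi> x / ereal (norm x)) \<longlongrightarrow> \<infinity>) at_infinity"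
    and L0: "ereal_convex \<phi>" "(\<phi> \<longlongrightarrow> \<infinity>) at_infinity" "\<And>x. 0 \<le> \<phi> x" "\<phi> 0 = 0"
    using \<phi> by (auto simp: class_L0'_def class_L0_def class_L_def)
  have \<phi>_a: "\<phi> x = ereal (a x)" for x
    using L0'(1)[of x] L0(3)[of x] by (cases "\<phi> x") (auto simp: a_def)
  then show "\<phi> = (\<lambda>x. ereal (a x))" by auto
  show a0: "a 0 = 0" using L0(4) by (simp add: \<phi>_a zero_ereal_def)
  show nonneg: "0 \<le> a x" for x using L0(3)[of x] by (simp add: \<phi>_a)
  show conv: "convex_on UNIV a"
  proof (rule convex_onI)
    fix t :: real and x y :: "real ^ 'n"
    assume "0 < t" "t < 1"
    have "\<phi> (u *\<^sub>R x + (1 - u) *\<^sub>R y) \<le> ereal u * \<phi> x + ereal (1 - u) * \<phi> y"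
      if "0 < u" "u < 1" for u
      using L0(1) that by (simp add: ereal_convex_def)
    from this[of "1 - t"] \<open>0 < t\<close> \<open>t < 1\<close>
    show "a ((1 - t) *\<^sub>R x + t *\<^sub>R y) \<le> (1 - t) * a x + t * a y"
      by (simp add: \<phi>_a)
  qed auto
  show "filterlim a at_top at_infinity"
    using L0(2) by (simp add: tendsto_PInfty \<phi>_a filterlim_at_top_dense)
  show grad: "GDERIV a x :> grad \<phi> x" for x
    using L0'(2) unfolding a_def C1_def by (intro GDERIV_grad) auto
  show "continuous_on UNIV (grad \<phi>)" using L0'(2) by (simp add: C1_def)
  show "a x < x \<bullet> grad \<phi> x" if "x \<noteq> 0"
  proof -
    have "\<phi> (u *\<^sub>R x + (1 - u) *\<^sub>R 0) < ereal u * \<phi> x + ereal (1 - u) * \<phi> 0"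
      if "0 < u" "u < 1" for u
      using L0'(3) that \<open>x \<noteq> 0\<close> unfolding ereal_strictly_convex_def
      by (simp del: scaleR_zero_right)
    from this[of "1 / 2"] have "2 * a ((1 / 2) *\<^sub>R x) < a x"
      by (simp add: \<phi>_a a0)
    moreover have "a x + ((1 / 2) *\<^sub>R x - x) \<bullet> grad \<phi> x \<le> a ((1 / 2) *\<^sub>R x)"
      by (intro convex_on_gradient_le conv grad)
    moreover have "((1 / 2) *\<^sub>R x - x) \<bullet> grad \<phi> x = - (x \<bullet> grad \<phi> x) / 2"
      by (simp add: inner_diff_left)
    ultimately show ?thesis by simp
  qed
  show "bdd_above (range (\<lambda>x. x \<bullet> y - a x))"
  proof (rule bdd_above_conjugate)
    show "continuous_on UNIV a" by (intro convex_on_continuous conv) auto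
    show "filterlim (\<lambda>x. a x / norm x) at_top at_infinity"
      unfolding filterlim_at_top_dense
    proof
      fix Z :: real
      have "\<forall>\<^sub>F x in at_infinity. ereal Z < \<phi> x / ereal (norm x)"
        using L0'(4) by (simp add: tendsto_PInfty)
      moreover have "\<forall>\<^sub>F x in at_infinity. (1::real) \<le> norm (x :: real ^ 'n)"
        by (auto simp: eventually_at_infinity)
      ultimately show "\<forall>\<^sub>F x in at_infinity. Z < a x / norm x"
        by eventually_elim (auto simp: \<phi>_a split: if_splits)
    qed
  qed
qed

text \<open>The conjugate of \<open>t\<^bsup>1/p\<^esup> b(t\<^bsup>-1/p\<^esup> x)\<close> is \<open>t\<^bsup>1/p\<^esup> b\<^sup>*\<close>, so that the dilation becomes the factor
  \<open>t\<close> in front of the \<open>p\<close>-th power.\<close>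

lemma Lp_sum_scale_exp_neg:
  fixes a b :: "real ^ 'n \<Rightarrow> real"
  assumes p: "1 < p" and t: "0 < t"
    and a: "\<And>y. bdd_above (range (\<lambda>x. x \<bullet> y - a x))" "a 0 = 0"
    and b: "\<And>y. bdd_above (range (\<lambda>x. x \<bullet> y - b x))" "b 0 = 0"
  shows "Lp_sum p (\<lambda>x. exp_neg (ereal (a x))) (Lp_scale p t (\<lambda>x. exp_neg (ereal (b x))))
    = (\<lambda>x. exp (- conjugate (\<lambda>y. Lp_comb p t (conjugate a y) (conjugate b y)) x))"
proof
  fix x
  define s where "s = t powr (1 / p)"
  have s: "0 < s" "s powr p = t" using t p by (auto simp: s_def powr_powr)
  have pot: "potential (\<lambda>x. exp_neg (ereal (h x))) = (\<lambda>x. ereal (h x))" for h :: "real ^ 'n \<Rightarrow> real"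
    by (rule potential_exp_neg) simp
  have "Lp_scale p t (\<lambda>x. exp_neg (ereal (b x))) = (\<lambda>x. exp_neg (ereal (s * b (inverse s *\<^sub>R x))))"
    unfolding Lp_scale_def pot s_def by (simp add: powr_minus minus_divide_left[symmetric])
  then have pot_s: "potential (Lp_scale p t (\<lambda>x. exp_neg (ereal (b x)))) = (\<lambda>x. ereal (s * b (inverse s *\<^sub>R x)))"
    by (simp only: pot)
  have "legendre (\<lambda>x. ereal (s * b (inverse s *\<^sub>R x))) y = ereal (s * conjugate b y)" for y
    using legendre_ereal[OF conjugate_scale(1)[OF s(1) b(1)]] conjugate_scale(2)[OF s(1) b(1)] by simp
  then have "Lp_infconv p (\<lambda>x. ereal (a x)) (\<lambda>x. ereal (s * b (inverse s *\<^sub>R x)))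
      = legendre (\<lambda>y. ereal (Lp_comb p t (conjugate a y) (conjugate b y)))"
    using s conjugate_nonneg[OF b]
    by (simp add: Lp_infconv_def legendre_ereal a(1) ereal_powr_def Lp_comb_def powr_mult)
  moreover have "legendre (\<lambda>y. ereal (Lp_comb p t (conjugate a y) (conjugate b y))) x
      = ereal (conjugate (\<lambda>y. Lp_comb p t (conjugate a y) (conjugate b y)) x)"
    using p t conjugate_upper[OF a(1)] conjugate_nonneg[OF a]
    by (intro legendre_ereal bdd_above_conjugate_Lp_comb[where a = a]) auto
  ultimately show "Lp_sum p (\<lambda>x. exp_neg (ereal (a x))) (Lp_scale p t (\<lambda>x. exp_neg (ereal (b x)))) x
      = exp (- conjugate (\<lambda>y. Lp_comb p t (conjugate a y) (conjugate b y)) x)"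
    by (simp add: Lp_sum_def pot pot_s) (simp add: exp_neg_def)
qed

theorem theorem1p2:
  fixes \<phi> \<psi> :: "real ^ 'n \<Rightarrow> ereal" and f g :: "real ^ 'n \<Rightarrow> real" and p :: real
  assumes "1 < p"
    and "\<phi> \<in> class_L0'" and "f = (\<lambda>x. exp_neg (\<phi> x))"
    and "\<psi> \<in> class_L0'" and "g = (\<lambda>x. exp_neg (\<psi> x))"
    and "admissible_perturbation p f g"
  shows "(difference_quotient p f g \<longlongrightarrow> delta_J p f g) (at_right 0)
    \<and> integrable lborel (\<lambda>x. real_of_ereal (legendre \<psi> (grad \<phi> x)) powr p
          * real_of_ereal (legendre \<phi> (grad \<phi> x)) powr (1 - p) * f x)
    \<and> delta_J p f g = 1 / p * (LINT x|lborel.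
          real_of_ereal (legendre \<psi> (grad \<phi> x)) powr p
          * real_of_ereal (legendre \<phi> (grad \<phi> x)) powr (1 - p) * f x)
    \<and> integrable (mu f) (\<lambda>y. real_of_ereal (legendre \<psi> y) powr p
          * real_of_ereal (legendre \<phi> y) powr (1 - p))
    \<and> delta_J p f g = 1 / p * (LINT y|mu f.
          real_of_ereal (legendre \<psi> y) powr p * real_of_ereal (legendre \<phi> y) powr (1 - p))"
proof -
  define a where "a x = real_of_ereal (\<phi> x)" for x
  define b where "b x = real_of_ereal (\<psi> x)" for x
  define A where "A = conjugate a"
  define B where "B = conjugate b"
  define D where "D = grad \<phi>"
  note a = class_L0'_real[OF assms(2), folded a_def]
  note b = class_L0'_real[OF assms(4), folded b_def]
  have \<phi>_a: "\<phi> x = ereal (a x)" for x by (rule fun_cong[OF a(1)])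
  have \<psi>_b: "\<psi> x = ereal (b x)" for x by (rule fun_cong[OF b(1)])
  have f': "f = (\<lambda>x. exp_neg (ereal (a x)))" and g': "g = (\<lambda>x. exp_neg (ereal (b x)))"
    unfolding assms(3,5) \<phi>_a \<psi>_b by (rule refl)+
  have f: "f = (\<lambda>x. exp (- a x))"
    by (simp add: f' exp_neg_def)
  have pot: "potential f = \<phi>" "potential g = \<psi>"
    unfolding assms(3,5) by (rule potential_exp_neg, simp add: \<phi>_a \<psi>_b)+
  have leg: "legendre \<phi> y = ereal (A y)" "legendre \<psi> y = ereal (B y)" for y
    using legendre_ereal[OF a(9), of y] legendre_ereal[OF b(9), of y]
    unfolding A_def B_def \<phi>_a[symmetric] \<psi>_b[symmetric] by simp_all
  obtain c where c: "0 < c" "convex_on UNIV (\<lambda>y. A y powr p - c * B y powr p)"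
    using assms(6) by (auto simp: admissible_perturbation_def pot leg)
  have zero: "A 0 = 0" "B 0 = 0"
    unfolding A_def B_def by (intro conjugate_zero a(2,3) b(2,3))+
  have le: "c * B y powr p \<le> A y powr p" for y
    using powr_le_of_convex_diff[OF assms(1) c(1) _ zero(1) _ zero(2) c(2)]
      convex_conjugate[OF a(9)] conjugate_nonneg[OF a(9,2)] by (simp add: A_def)
  note var = Lp_variation_exp_neg[OF assms(1) a(4,2,3,5,6,7,8,9) b(9,2) c(1) le[unfolded A_def B_def],
      folded A_def B_def D_def]
  define I where "I = (LINT x|lborel. B (D x) powr p * A (D x) powr (1 - p) * exp (- a x))"
  have "difference_quotient p f g t = ((LINT x|lborel. exp (- conjugate (\<lambda>y. Lp_comb p t (A y) (B y)) x))
              - (LINT x|lborel. exp (- a x))) / t" if "0 < t" for t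
  proof -
    have "Lp_sum p f (Lp_scale p t g)
        = (\<lambda>x. exp (- conjugate (\<lambda>y. Lp_comb p t (A y) (B y)) x))"
      unfolding A_def B_def f' g' by (rule Lp_sum_scale_exp_neg[OF assms(1) that a(9,2) b(9,2)])
    then show ?thesis by (simp add: difference_quotient_def total_mass_def f)
  qed
  then have lim: "(difference_quotient p f g \<longlongrightarrow> 1 / p * I) (at_right 0)"
    using var(2) unfolding I_def
    by (auto simp: eventually_at_filter elim!: Lim_transform_eventually)
  then have delta: "delta_J p f g = 1 / p * I"
    unfolding delta_J_def by (intro tendsto_Lim) auto
  have cont: "continuous_on UNIV A" "continuous_on UNIV B" "continuous_on UNIV a"
    unfolding A_def B_def
    by (intro convex_on_continuous convex_conjugate a b; simp)+
  have [measurable]: "A \<in> borel_measurable borel" "B \<in> borel_measurable borel"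
    "a \<in> borel_measurable borel" "D \<in> borel_measurable borel"
    using cont a(7) unfolding D_def by (auto intro: borel_measurable_continuous_onI)
  have mu: "mu f = distr (density lborel (\<lambda>x. ennreal (exp (- a x)))) borel D"
    by (simp add: mu_def pot D_def) (simp add: f)
  have mu_int: "integrable (mu f) (\<lambda>y. B y powr p * A y powr (1 - p))"
    unfolding mu using var(1)
    by (subst integrable_distr_eq, simp_all) (subst integrable_density, auto simp: mult_ac)
  have mu_I: "(LINT y|mu f. B y powr p * A y powr (1 - p)) = I"
    unfolding mu I_def
    by (subst integral_distr, simp_all) (subst integral_density, auto simp: mult_ac)
  have vf: "integrable lborel (\<lambda>x. B (D x) powr p * A (D x) powr (1 - p) * f x)"
    "(LINT x|lborel. B (D x) powr p * A (D x) powr (1 - p) * f x) = I"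
    using var(1) by (simp_all add: f I_def)
  show ?thesis
    unfolding leg real_of_ereal.simps D_def[symmetric] mu_I vf(2) delta
    using lim vf(1) mu_int by (intro conjI refl)
qed

end
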